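(* Let $\theta_a,\theta_d>0$, let $n,N$ be positive integers, $E=\mathbb{R}^N$, and let $\eta$ be a Borel probability measure on $E$ supported on $\{\mathbf{x}\in E:|\mathbf{x}|_\infty\le R\}$ for some $R>0$, with mean $\overline{\eta}=\int_E\mathbf{x}\,d\eta(\mathbf{x})$. Let $\rho$ be a Borel probability distribution on $\mathsf{X}$ such that $\rho\circ\pi^{-1}=\sigma$, where \[\sigma=\frac{1}{(\theta_d+\theta_a)^n}\sum_{k=0}^{n}\binom{n}{k}\theta_d^{\,n-k}\theta_a^{\,k}\,\delta_k,\] and such that $f_i$ is $\rho$-integrable for every $i\in\{0,\dots,n\}$. Let $X$ be the continuous-time process on $\mathsf{X}$ constructed from $\rho$ as described in the context. Then for every $t>0$, \[\frac{\partial}{\partial t}\mathbb{E}(f_n(X_t))=\frac{\overline{\eta}\,\theta_d}{(\theta_d+\theta_a)^n}\Big((\theta_d+\theta_a)^n-\theta_d^{\,n}\Big).\]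
   Context: Notation: for a positive integer $k$, $[k]=\{0,1,\dots,k-1\}$. Elements of $\{0,1\}^{[n]}$ and $E^{[n+1]}$ are functions; for $\psi\in\{0,1\}^{[n]}$ let $|\psi|=\sum_{i\in[n]}\psi(i)$. The state space is $\mathsf{X}=\{(\psi,\mathbf{v})\in\{0,1\}^{[n]}\times E^{[n+1]}:\sum_{i\in[n]}\psi(i)(\mathbf{v}(i)-\mathbf{v}(n))=0\}$, with the subspace topology of the product topology (discrete on $\{0,1\}$, Euclidean on $E$) and its Borel $\sigma$-algebra. (Interpretation: $n$ objects, $\psi(i)$ = attached(1)/detached(0) status of object $i$, $\mathbf{v}(i)$ its location, $\mathbf{v}(n)$ the centroid of attached objects.) Let $\pi:\mathsf{X}\to\{0,\dots,n\}$, $\pi(\psi,\mathbf{v})=|\psi|$, and $f_i(\psi,\mathbf{v})=\mathbf{v}(i)$ for $i\in[n+1]$. For $i\in[n]$: $r_i(\psi)=\frac{\theta_d\psi(i)+\theta_a(1-\psi(i))}{\theta_d|\psi|+\theta_a(n-|\psi|)}$, and $s_i(\psi)$ agrees with $\psi$ except $s_i(\psi)(i)=1-\psi(i)$. For $\mathsf{x}=(\psi,\mathbf{v})\in\mathsf{X}$ and $i\in[n]$, let $\lambda_i^{\mathsf{x}}$ be the law of the random element $(s_i(\psi),\mathbf{w})$ of $\{0,1\}^{[n]}\times E^{[n+1]}$, where $\mathbf{w}(j)=\mathbf{v}(j)$ for $j\in[n]\setminus\{i\}$ and $(\mathbf{w}(i),\mathbf{w}(n))$ equals: $(\mathbf{v}(i),\mathbf{v}(n))$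 if $|\psi|=\psi(i)=1$; $(\mathbf{v}(i),\mathbf{v}(n)-\frac{\mathbf{v}(i)-\mathbf{v}(n)}{|\psi|-1})$ if $|\psi|>\psi(i)=1$; $(\mathbf{x}+\mathbf{v}(n),\frac{\mathbf{x}}{|\psi|+1}+\mathbf{v}(n))$ with $\mathbf{x}$ an $\eta$-distributed random vector if $\psi(i)=0$. The jump kernel is $\mu(\mathsf{x},B)=\sum_{i\in[n]}r_i(\psi)\lambda_i^{\mathsf{x}}(B)$ for Borel $B\subseteq\mathsf{X}$; the rate function is $c(\psi,\mathbf{v})=\theta_d|\psi|+\theta_a(n-|\psi|)$. Construction of $X$ from $\rho$: let $Y$ be a discrete-time Markov chain on $\mathsf{X}$ with transition kernel $\mu$ and $Y_0\sim\rho$; let $(\gamma_k)_{k\ge1}$ be i.i.d. standard exponential random variables with $\{Y,\gamma_1,\gamma_2,\dots\}$ independent; $\tau_0=0$, $\tau_k=\sum_{i=1}^k\gamma_i/c(Y_{i-1})$; and $X_t=Y_k$ for $t\in[\tau_k,\tau_{k+1})$. *)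

theory Defs
  imports "HOL-Probability.Probability"
begin

text \<open>States: pairs (psi, v) with psi : [n] -> {0,1} (encoded as bool, True = attached)
  and v : [n+1] -> E, E = real^'N.  Functions are extensional (undefined outside their domain),
  as in the finite product measure PiM.\<close>

type_synonym 'N state = "(nat \<Rightarrow> bool) \<times> (nat \<Rightarrow> real^'N)"

definition card_psi :: "nat \<Rightarrow> (nat \<Rightarrow> bool) \<Rightarrow> nat" where
  "card_psi n \<psi> = card {i. i < n \<and> \<psi> i}"

definition Xset :: "nat \<Rightarrow> 'N::finite state set" where
  "Xset n = {(\<psi>, v). \<psi> \<in> extensional {..<n} \<and> v \<in> extensional {..<Suc n} \<and>
              (\<Sum>i<n. of_bool (\<psi> i) *\<^sub>R (v i - v n)) = 0}"

text \<open>Borel sigma algebra of the subspace topology of the product topology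
  (discrete on {0,1}, Euclidean on E); for finite products of second countable spaces this
  is the product sigma algebra restricted to Xset.\<close>
definition stateM :: "nat \<Rightarrow> 'N::finite state measure" where
  "stateM n = restrict_space
     (PiM {..<n} (\<lambda>_. count_space UNIV) \<Otimes>\<^sub>M PiM {..<Suc n} (\<lambda>_. (borel :: (real^'N) measure)))
     (Xset n)"

definition rate_fun :: "real \<Rightarrow> real \<Rightarrow> nat \<Rightarrow> 'N::finite state \<Rightarrow> real" where
  "rate_fun \<theta>a \<theta>d n x = \<theta>d * real (card_psi n (fst x)) + \<theta>a * (real n - real (card_psi n (fst x)))"

definition r_i :: "real \<Rightarrow> real \<Rightarrow> nat \<Rightarrow> nat \<Rightarrow> (nat \<Rightarrow> bool) \<Rightarrow> real" where
  "r_i \<theta>a \<theta>d n i \<psi> =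
     (\<theta>d * of_bool (\<psi> i) + \<theta>a * (1 - of_bool (\<psi> i))) /
     (\<theta>d * real (card_psi n \<psi>) + \<theta>a * (real n - real (card_psi n \<psi>)))"

definition s_i :: "nat \<Rightarrow> (nat \<Rightarrow> bool) \<Rightarrow> (nat \<Rightarrow> bool)" where
  "s_i i \<psi> = \<psi>(i := \<not> \<psi> i)"

definition lam_i :: "(real^'N::finite) measure \<Rightarrow> nat \<Rightarrow> nat \<Rightarrow> 'N state \<Rightarrow> 'N state set \<Rightarrow> real" where
  "lam_i \<eta> n i x B = (let \<psi> = fst x; v = snd x; k = card_psi n \<psi> in
     if \<psi> i then
       (if k = 1 then indicator B (s_i i \<psi>, v)
        else indicator B (s_i i \<psi>, v(n := v n - (1 / (real k - 1)) *\<^sub>R (v i - v n))))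
     else measure \<eta> {y \<in> space \<eta>. (s_i i \<psi>, v(i := y + v n, n := (1 / (real k + 1)) *\<^sub>R y + v n)) \<in> B})"

definition jump_kernel :: "real \<Rightarrow> real \<Rightarrow> (real^'N::finite) measure \<Rightarrow> nat \<Rightarrow> 'N state \<Rightarrow> 'N state set \<Rightarrow> real" where
  "jump_kernel \<theta>a \<theta>d \<eta> n x B = (\<Sum>i<n. r_i \<theta>a \<theta>d n i (fst x) * lam_i \<eta> n i x B)"

definition sigma_w :: "real \<Rightarrow> real \<Rightarrow> nat \<Rightarrow> nat \<Rightarrow> real" where
  "sigma_w \<theta>a \<theta>d n k = (if k \<le> n then
      real (n choose k) * \<theta>d ^ (n - k) * \<theta>a ^ k / (\<theta>d + \<theta>a) ^ n else 0)"

definition jump_time :: "('N::finite state \<Rightarrow> real) \<Rightarrow> (nat \<Rightarrow> 'w \<Rightarrow> 'N state) \<Rightarrow> (nat \<Rightarrow> 'w \<Rightarrow> real) \<Rightarrow> nat \<Rightarrow> 'w \<Rightarrow> real" where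
  "jump_time c Y \<gamma> k \<omega> = (\<Sum>i\<in>{1..k}. \<gamma> i \<omega> / c (Y (i - 1) \<omega>))"

definition Xproc :: "('N::finite state \<Rightarrow> real) \<Rightarrow> (nat \<Rightarrow> 'w \<Rightarrow> 'N state) \<Rightarrow> (nat \<Rightarrow> 'w \<Rightarrow> real) \<Rightarrow> real \<Rightarrow> 'w \<Rightarrow> 'N state" where
  "Xproc c Y \<gamma> t \<omega> = Y (LEAST k. jump_time c Y \<gamma> k \<omega> \<le> t \<and> t < jump_time c Y \<gamma> (Suc k) \<omega>) \<omega>"

end

theory Submission
  imports Defs
begin

text \<open>The generator of the process maps \<open>f\<^sub>n\<close> to \<open>\<theta>a (n - k) / (k + 1)\<close> times the mean of \<open>\<eta>\<close>, where \<open>k\<close> is the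
  number of attached objects: detachments contribute nothing because the centroid condition makes their
  shifts cancel. The number of attached objects is itself a birth-death chain, and \<open>\<sigma>\<close> is reversible for
  it, so the expected drift is constant in time; by detailed balance it equals \<open>\<theta>d (1 - \<sigma> 0)\<close> times the mean.

  Dynkin's formula turns this into a statement about the jump construction. It rests on a single exponential
  clock: if \<open>\<xi>\<close> is standard exponential and independent of \<open>T \<ge> 0\<close>, then
  \<open>P (T + \<xi> / a \<le> s) = a \<integral>\<^sub>0\<^sup>s P (T \<le> r < T + \<xi> / a) dr\<close>. Conditionally on the chain this applies
  to every jump, and it also bounds the probability of \<open>k\<close> jumps by time \<open>s\<close> by \<open>(C s)\<^sup>k / k!\<close>, which beats
  the geometric growth of the first moments of the chain. That the law \<open>\<sigma>\<close> persists follows by iterating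
  Dynkin's formula on functions of the number of attached objects.\<close>

section \<open>Exponential clocks\<close>

lemma power_over_fact_sums_exp: "(\<lambda>k. (x :: real) ^ k / fact k) sums exp x"
  using exp_converges[of x] by (simp add: field_simps)

lemma power_over_fact_tendsto_0: "(\<lambda>k. (x :: real) ^ k / fact k) \<longlonglongrightarrow> 0"
  using power_over_fact_sums_exp by (intro summable_LIMSEQ_zero sums_summable)

lemma has_real_derivative_power_over_fact:
  fixes C :: real
  shows "((\<lambda>s. (C * s) ^ Suc k / fact (Suc k)) has_real_derivative C * ((C * s) ^ k / fact k)) (at s within A)"
proof -
  have "((\<lambda>s. (C * s) ^ Suc k / fact (Suc k)) has_real_derivative
      (1 + real k) * (C * (C * s) ^ k) / fact (Suc k)) (at s within A)"
    by (intro DERIV_cdivide DERIV_power_Suc DERIV_cmult_Id)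
  moreover have "(1 + real k) * (C * (C * s) ^ k) / ((1 + real k) * fact k) = C * ((C * s) ^ k / fact k)"
    by (subst mult_divide_mult_cancel_left) auto
  ultimately show ?thesis by simp
qed

lemma set_integral_le_power_over_fact:
  fixes f :: "real \<Rightarrow> real"
  assumes "0 \<le> s" and f: "set_integrable lborel {0..s} f"
    and dominated: "\<And>r. 0 \<le> r \<Longrightarrow> r \<le> s \<Longrightarrow> f r \<le> B * (C * ((C * r) ^ k / fact k))"
  shows "(LBINT r:{0..s}. f r) \<le> B * ((C * s) ^ Suc k / fact (Suc k))"
proof -
  let ?g = "\<lambda>r. B * (C * ((C * r) ^ k / fact k))"
  have "((\<lambda>r. B * ((C * r) ^ Suc k / fact (Suc k))) has_real_derivative ?g r) (at r within A)" for r A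
    by (rule DERIV_cmult[OF has_real_derivative_power_over_fact])
  then have "(LBINT r:{0..s}. ?g r) = B * ((C * s) ^ Suc k / fact (Suc k)) - B * ((C * 0) ^ Suc k / fact (Suc k))"
    unfolding set_lebesgue_integral_def using \<open>0 \<le> s\<close>
    by (intro integral_FTC_Icc) (auto intro!: continuous_intros
        simp: has_real_derivative_iff_has_vector_derivative[symmetric])
  moreover have "(LBINT r:{0..s}. f r) \<le> (LBINT r:{0..s}. ?g r)"
    using dominated by (intro set_integral_mono[OF f] borel_integrable_atLeastAtMost') (auto intro!: continuous_intros)
  ultimately show ?thesis by simp
qed

lemma set_integrable_lborel_bounded:
  fixes f :: "real \<Rightarrow> real"
  assumes [measurable]: "f \<in> borel_measurable borel" and "\<And>r. a \<le> r \<Longrightarrow> r \<le> b \<Longrightarrow> \<bar>f r\<bar> \<le> B"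
  shows "set_integrable lborel {a..b} f"
proof (rule set_integrable_bound[where f="\<lambda>_. B"])
  show "set_integrable lborel {a..b} (\<lambda>_. B)"
    by (simp add: set_integrable_def integrable_indicator_iff emeasure_lborel_Icc_eq)
  show "set_borel_measurable lborel {a..b} f"
    unfolding set_borel_measurable_def by measurable
qed (use assms in \<open>auto intro!: AE_I2 order_trans[OF _ abs_ge_self]\<close>)

lemma set_lborel_integral_sums:
  fixes e :: "nat \<Rightarrow> real \<Rightarrow> real"
  assumes [measurable]: "\<And>k. e k \<in> borel_measurable borel"
    and bound: "\<And>k r. a \<le> r \<Longrightarrow> r \<le> b \<Longrightarrow> \<bar>e k r\<bar> \<le> B k" and summable: "summable B"
  shows "(\<lambda>k. LBINT r:{a..b}. e k r) sums (LBINT r:{a..b}. (\<Sum>k. e k r))"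
proof -
  let ?h = "\<lambda>k r. indicator {a..b} r *\<^sub>R e k r"
  have norm_le: "norm (?h k r) \<le> indicator {a..b} r *\<^sub>R B k" for k r
    using bound by (simp add: indicator_def)
  have integrable_B: "integrable lborel (\<lambda>r. indicator {a..b} r *\<^sub>R B k)" for k
    using set_integrable_lborel_bounded[of "\<lambda>_. B k" a b "\<bar>B k\<bar>"] by (simp add: set_integrable_def)
  have integrable_h: "integrable lborel (?h k)" for k
    using set_integrable_lborel_bounded[OF _ bound] by (simp add: set_integrable_def)
  have "(\<lambda>k. integral\<^sup>L lborel (?h k)) sums (\<integral>r. (\<Sum>k. ?h k r) \<partial>lborel)"
  proof (rule sums_integral[OF integrable_h])
    show "AE r in lborel. summable (\<lambda>k. norm (?h k r))"
      using norm_le by (intro AE_I2 summable_comparison_test'[OF summable_mult[OF summable]]) simp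
    have "(\<integral>r. norm (?h k r) \<partial>lborel) \<le> measure lborel {a..b} * B k" for k
    proof -
      have "(\<integral>r. norm (?h k r) \<partial>lborel) \<le> (\<integral>r. indicator {a..b} r *\<^sub>R B k \<partial>lborel)"
        by (intro Bochner_Integration.integral_mono integrable_norm integrable_h integrable_B norm_le)
      then show ?thesis by simp
    qed
    then show "summable (\<lambda>k. \<integral>r. norm (?h k r) \<partial>lborel)"
      by (intro summable_comparison_test'[OF summable_mult[OF summable]]) simp
  qed
  moreover have "(\<Sum>k. ?h k r) = indicator {a..b} r *\<^sub>R (\<Sum>k. e k r)" for r
    by (simp add: indicator_def)
  ultimately show ?thesis
    by (simp add: set_lebesgue_integral_def)
qed

lemma integrable_mult_abs_le_1:
  fixes f g :: "'a \<Rightarrow> real"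
  assumes integrable_f: "integrable M f" and "g \<in> borel_measurable M" and "\<And>x. x \<in> space M \<Longrightarrow> \<bar>g x\<bar> \<le> 1"
  shows "integrable M (\<lambda>x. f x * g x)"
  by (rule Bochner_Integration.integrable_bound[OF integrable_f])
     (use assms in \<open>auto simp: abs_mult intro!: mult_right_le_one_le\<close>)

lemma (in prob_space) expectation_indicator_vimage:
  assumes [measurable]: "random_variable N X" "A \<in> sets N"
  shows "expectation (\<lambda>\<omega>. indicator A (X \<omega>) :: real) = prob {\<omega> \<in> space M. X \<omega> \<in> A}"
proof -
  have "expectation (\<lambda>\<omega>. indicator A (X \<omega>) :: real) = (\<integral>\<omega>. indicator {\<omega> \<in> space M. X \<omega> \<in> A} \<omega> \<partial>M)"
    by (intro Bochner_Integration.integral_cong) (auto simp: indicator_def)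
  then show ?thesis by simp
qed

lemma (in prob_space) distr_Pair_indep_set:
  assumes [measurable]: "random_variable S X" "random_variable T Z"
    and indep: "indep_set {X -` A \<inter> space M | A. A \<in> sets S} {Z -` A \<inter> space M | A. A \<in> sets T}"
  shows "distr M (S \<Otimes>\<^sub>M T) (\<lambda>\<omega>. (X \<omega>, Z \<omega>)) = distr M S X \<Otimes>\<^sub>M distr M T Z"
proof (rule pair_measure_eqI[symmetric])
  interpret X: prob_space "distr M S X" by (rule prob_space_distr) measurable
  interpret Z: prob_space "distr M T Z" by (rule prob_space_distr) measurable
  show "sigma_finite_measure (distr M S X)" "sigma_finite_measure (distr M T Z)" ..
  fix A B assume "A \<in> sets (distr M S X)" "B \<in> sets (distr M T Z)"
  then have [measurable]: "A \<in> sets S" "B \<in> sets T" by simp_all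
  have "emeasure (distr M (S \<Otimes>\<^sub>M T) (\<lambda>\<omega>. (X \<omega>, Z \<omega>))) (A \<times> B)
      = prob ((X -` A \<inter> space M) \<inter> (Z -` B \<inter> space M))"
    by (subst emeasure_distr) (auto simp: emeasure_eq_measure intro!: arg_cong[where f=prob])
  also have "prob ((X -` A \<inter> space M) \<inter> (Z -` B \<inter> space M))
      = prob (X -` A \<inter> space M) * prob (Z -` B \<inter> space M)"
    by (intro indep_setD[OF indep]) auto
  finally show "emeasure (distr M S X) A * emeasure (distr M T Z) B
      = emeasure (distr M (S \<Otimes>\<^sub>M T) (\<lambda>\<omega>. (X \<omega>, Z \<omega>))) (A \<times> B)"
    by (simp add: emeasure_distr emeasure_eq_measure ennreal_mult)
qed simp

lemma (in prob_space) integral_of_product_law: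
  fixes f :: "'b \<times> 'c \<Rightarrow> 'd :: {banach, second_countable_topology}"
  assumes X[measurable]: "random_variable S X" and [measurable]: "random_variable T Z"
    and joint: "distr M (S \<Otimes>\<^sub>M T) (\<lambda>\<omega>. (X \<omega>, Z \<omega>)) = distr M S X \<Otimes>\<^sub>M distr M T Z"
    and f[measurable]: "f \<in> borel_measurable (S \<Otimes>\<^sub>M T)"
    and integrable_joint: "integrable M (\<lambda>\<omega>. f (X \<omega>, Z \<omega>))"
  shows "(\<integral>\<omega>. f (X \<omega>, Z \<omega>) \<partial>M) = (\<integral>\<omega>. \<integral>\<omega>'. f (X \<omega>, Z \<omega>') \<partial>M \<partial>M)"
proof -
  interpret X: prob_space "distr M S X" by (rule prob_space_distr) measurable
  interpret Z: prob_space "distr M T Z" by (rule prob_space_distr) measurable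
  interpret XZ: pair_prob_space "distr M S X" "distr M T Z" ..
  have "integrable (distr M S X \<Otimes>\<^sub>M distr M T Z) f"
    unfolding joint[symmetric] using integrable_joint by (simp add: integrable_distr_eq)
  from XZ.integral_fst'[OF this]
  have "(\<integral>\<omega>. f (X \<omega>, Z \<omega>) \<partial>M) = (\<integral>x. \<integral>z. f (x, z) \<partial>distr M T Z \<partial>distr M S X)"
    by (simp add: integral_distr flip: joint)
  also have "\<dots> = (\<integral>\<omega>. \<integral>z. f (X \<omega>, z) \<partial>distr M T Z \<partial>M)"
    by (rule integral_distr) measurable
  also have "\<dots> = (\<integral>\<omega>. \<integral>\<omega>'. f (X \<omega>, Z \<omega>') \<partial>M \<partial>M)"
  proof (intro Bochner_Integration.integral_cong refl integral_distr)
    fix \<omega> assume "\<omega> \<in> space M"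
    then have "X \<omega> \<in> space S" by (rule measurable_space[OF X])
    then show "(\<lambda>z. f (X \<omega>, z)) \<in> borel_measurable T" by measurable
  qed measurable
  finally show ?thesis .
qed

lemma (in prob_space) expectation_set_lborel_integral:
  fixes f :: "real \<Rightarrow> 'a \<Rightarrow> real"
  assumes f[measurable]: "case_prod f \<in> borel_measurable (borel \<Otimes>\<^sub>M M)"
    and bounded: "\<And>r \<omega>. \<omega> \<in> space M \<Longrightarrow> \<bar>f r \<omega>\<bar> \<le> B"
  shows "(\<integral>\<omega>. (LBINT r:{a..b}. f r \<omega>) \<partial>M) = (LBINT r:{a..b}. \<integral>\<omega>. f r \<omega> \<partial>M)"
proof -
  interpret P: pair_sigma_finite lborel M ..
  let ?g = "\<lambda>r \<omega>. indicator {a..b} r *\<^sub>R f r \<omega>"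
  have integrable_B: "integrable lborel (\<lambda>r. indicator {a..b} r *\<^sub>R B)"
    using set_integrable_lborel_bounded[of "\<lambda>_. B" a b "\<bar>B\<bar>"] by (simp add: set_integrable_def)
  have [measurable]: "(\<lambda>r. \<integral>\<omega>. norm (?g r \<omega>) \<partial>M) \<in> borel_measurable lborel"
    by measurable
  have "integrable (lborel \<Otimes>\<^sub>M M) (case_prod ?g)"
  proof (rule P.Fubini_integrable)
    have norm_le: "norm (?g r \<omega>) \<le> indicator {a..b} r *\<^sub>R B" if "\<omega> \<in> space M" for r \<omega>
      using bounded[OF that] by (simp add: indicator_def)
    have integrable_g: "integrable M (?g r)" for r
      by (rule integrable_const_bound[where B="indicator {a..b} r *\<^sub>R B"]) (use norm_le in auto)
    then show "AE r in lborel. integrable M (\<lambda>\<omega>. case_prod ?g (r, \<omega>))"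
      by simp
    have "(\<integral>\<omega>. norm (?g r \<omega>) \<partial>M) \<le> indicator {a..b} r *\<^sub>R B" for r
      by (rule integral_le_const) (use integrable_g norm_le in \<open>auto simp del: norm_scaleR\<close>)
    then show "integrable lborel (\<lambda>r. \<integral>\<omega>. norm (case_prod ?g (r, \<omega>)) \<partial>M)"
      by (intro Bochner_Integration.integrable_bound[OF integrable_B])
         (auto intro: order_trans[OF _ abs_ge_self])
  qed measurable
  from P.Fubini_integral[OF this] show ?thesis
    by (simp add: set_lebesgue_integral_def)
qed

lemma (in prob_space) AE_exponential_pos:
  assumes exponential: "distributed M lborel \<xi> (exponential_density l)"
  shows "AE \<omega> in M. 0 < \<xi> \<omega>"
proof -
  have "AE x in lborel. 0 < ennreal (exponential_density l x) \<longrightarrow> 0 < x"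
    using AE_lborel_singleton[of "0::real"] by eventually_elim (auto simp: exponential_density_def)
  then have "AE x in distr M lborel \<xi>. 0 < x"
    unfolding distributed_distr_eq_density[OF exponential] by (subst AE_density) auto
  then show ?thesis
    using distributed_measurable[OF exponential] by (subst (asm) AE_distr_iff) auto
qed

lemma set_integral_exponential_tail:
  fixes a s u :: real
  assumes "0 \<le> u"
  shows "(LBINT r:{0..s}. a * (indicator {..r} u * exp (- (a * (r - u)))))
    = indicator {..s} u - indicator {..s} u * exp (- (a * (s - u)))"
proof (cases "u \<le> s")
  case True
  have "((\<lambda>r. - exp (- (a * (r - u)))) has_real_derivative a * exp (- (a * (r - u)))) (at r within A)" for r A
    by (auto intro!: derivative_eq_intros)
  then have "(LBINT r:{u..s}. a * exp (- (a * (r - u)))) = - exp (- (a * (s - u))) - - exp (- (a * (u - u)))"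
    unfolding set_lebesgue_integral_def using True
    by (intro integral_FTC_Icc)
       (auto intro!: continuous_intros simp: has_real_derivative_iff_has_vector_derivative[symmetric])
  moreover have "(LBINT r:{0..s}. a * (indicator {..r} u * exp (- (a * (r - u)))))
      = (LBINT r:{u..s}. a * exp (- (a * (r - u))))"
    unfolding set_lebesgue_integral_def using \<open>0 \<le> u\<close>
    by (intro Bochner_Integration.integral_cong) (auto simp: indicator_def)
  ultimately show ?thesis
    using True by simp
next
  case False
  then have "indicator {0..s} r *\<^sub>R (a * (indicator {..r} u * exp (- (a * (r - u))))) = 0" for r
    by (auto simp: indicator_def)
  then have "(LBINT r:{0..s}. a * (indicator {..r} u * exp (- (a * (r - u))))) = (LBINT r:{0..s}. 0)"
    unfolding set_lebesgue_integral_def by (simp only: scaleR_zero_right)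
  with False show ?thesis by simp
qed

lemma (in prob_space) expectation_ring_after:
  assumes exponential: "distributed M lborel \<xi> (exponential_density 1)" and a: "0 < a"
  shows "expectation (\<lambda>\<omega>. if u \<le> r \<and> r < u + \<xi> \<omega> / a then 1 else 0 :: real)
    = indicator {..r} u * exp (- (a * (r - u)))"
proof (cases "u \<le> r")
  case True
  have "r < u + \<xi> \<omega> / a \<longleftrightarrow> a * (r - u) < \<xi> \<omega>" for \<omega>
    using a by (simp add: field_simps)
  then have "expectation (\<lambda>\<omega>. if u \<le> r \<and> r < u + \<xi> \<omega> / a then 1 else 0 :: real)
      = expectation (\<lambda>\<omega>. indicator {a * (r - u)<..} (\<xi> \<omega>))"
    using True by (simp add: indicator_def of_bool_def)
  also have "\<dots> = exp (- (a * (r - u)))"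
    using exponential_distributedD_gt[OF exponential, of "a * (r - u)"] distributed_measurable[OF exponential] True a
    by (simp add: expectation_indicator_vimage[where N=borel])
  finally show ?thesis using True by simp
qed simp

lemma (in prob_space) prob_le_diff_prob_add_exponential_le:
  assumes indep: "indep_var borel T borel \<xi>" and exponential: "distributed M lborel \<xi> (exponential_density 1)"
    and a: "0 < a"
  shows "prob {\<omega> \<in> space M. T \<omega> \<le> r} - prob {\<omega> \<in> space M. T \<omega> + \<xi> \<omega> / a \<le> r}
    = expectation (\<lambda>\<omega>. indicator {..r} (T \<omega>) * exp (- (a * (r - T \<omega>))))"
proof -
  note [measurable] = indep_var_rv1[OF indep] indep_var_rv2[OF indep]
  define h where "h = (\<lambda>(u, x). if u \<le> r \<and> r < u + x / a then 1 else 0 :: real)"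
  have [measurable]: "h \<in> borel_measurable (borel \<Otimes>\<^sub>M borel)"
    unfolding h_def by measurable
  have "prob {\<omega> \<in> space M. T \<omega> \<le> r} - prob {\<omega> \<in> space M. T \<omega> + \<xi> \<omega> / a \<le> r}
      = expectation (\<lambda>\<omega>. indicator {\<omega> \<in> space M. T \<omega> \<le> r} \<omega> - indicator {\<omega> \<in> space M. T \<omega> + \<xi> \<omega> / a \<le> r} \<omega>)"
    by (subst Bochner_Integration.integral_diff) (auto simp: emeasure_eq_measure)
  also have "\<dots> = expectation (\<lambda>\<omega>. h (T \<omega>, \<xi> \<omega>))"
  proof (rule integral_cong_AE)
    show "AE \<omega> in M. indicator {\<omega> \<in> space M. T \<omega> \<le> r} \<omega> - indicator {\<omega> \<in> space M. T \<omega> + \<xi> \<omega> / a \<le> r} \<omega>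
        = h (T \<omega>, \<xi> \<omega>)"
      using AE_exponential_pos[OF exponential] AE_space
    proof eventually_elim
      case (elim \<omega>)
      then have "0 < \<xi> \<omega> / a" using a by simp
      with elim show ?case by (auto simp: h_def indicator_def)
    qed
  qed measurable
  also have "\<dots> = expectation (\<lambda>\<omega>. expectation (\<lambda>\<omega>'. h (T \<omega>, \<xi> \<omega>')))"
  proof (rule integral_of_product_law)
    show "distr M (borel \<Otimes>\<^sub>M borel) (\<lambda>\<omega>. (T \<omega>, \<xi> \<omega>)) = distr M borel T \<Otimes>\<^sub>M distr M borel \<xi>"
      using indep by (simp add: indep_var_distribution_eq)
    show "integrable M (\<lambda>\<omega>. h (T \<omega>, \<xi> \<omega>))"
      by (rule integrable_const_bound[where B=1]) (auto simp: h_def)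
  qed measurable
  finally show ?thesis
    by (simp add: h_def expectation_ring_after[OF exponential a])
qed

lemma (in prob_space) prob_add_exponential_le:
  assumes indep: "indep_var borel T borel \<xi>" and exponential: "distributed M lborel \<xi> (exponential_density 1)"
    and nonneg: "AE \<omega> in M. 0 \<le> T \<omega>" and a: "0 < a"
  shows "prob {\<omega> \<in> space M. T \<omega> + \<xi> \<omega> / a \<le> s}
    = a * (LBINT r:{0..s}. prob {\<omega> \<in> space M. T \<omega> \<le> r} - prob {\<omega> \<in> space M. T \<omega> + \<xi> \<omega> / a \<le> r})"
proof -
  note [measurable] = indep_var_rv1[OF indep]
  let ?e = "\<lambda>r \<omega>. indicator {..r} (T \<omega>) * exp (- (a * (r - T \<omega>)))"
  note sojourn = prob_le_diff_prob_add_exponential_le[OF indep exponential a]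
  have e_le: "\<bar>?e r \<omega>\<bar> \<le> 1" for r \<omega>
    using a by (auto simp: indicator_def)
  have measurable_integrand: "case_prod (\<lambda>r \<omega>. a * ?e r \<omega>) \<in> borel_measurable (borel \<Otimes>\<^sub>M M)"
    by (simp add: indicator_def)
  have "a * (LBINT r:{0..s}. expectation (?e r)) = (LBINT r:{0..s}. expectation (\<lambda>\<omega>. a * ?e r \<omega>))"
    by simp
  also have "\<dots> = expectation (\<lambda>\<omega>. LBINT r:{0..s}. a * ?e r \<omega>)"
    by (rule expectation_set_lborel_integral[symmetric, where B=a, OF measurable_integrand])
       (use e_le a in \<open>auto simp: abs_mult\<close>)
  also have "\<dots> = expectation (\<lambda>\<omega>. indicator {..s} (T \<omega>) - ?e s \<omega>)"
  proof (rule integral_cong_AE)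
    show "AE \<omega> in M. (LBINT r:{0..s}. a * ?e r \<omega>) = indicator {..s} (T \<omega>) - ?e s \<omega>"
      using nonneg
      by eventually_elim (rule set_integral_exponential_tail)
    show "(\<lambda>\<omega>. LBINT r:{0..s}. a * ?e r \<omega>) \<in> borel_measurable M"
      unfolding set_lebesgue_integral_def indicator_def atMost_iff by measurable
  qed measurable
  also have "\<dots> = prob {\<omega> \<in> space M. T \<omega> \<le> s} - expectation (?e s)"
  proof (subst Bochner_Integration.integral_diff)
    show "integrable M (?e s)"
      by (rule integrable_const_bound[where B=1]) (use e_le in auto)
    show "expectation (\<lambda>\<omega>. indicator {..s} (T \<omega>)) - expectation (?e s)
        = prob {\<omega> \<in> space M. T \<omega> \<le> s} - expectation (?e s)"
      by (simp add: expectation_indicator_vimage[where N=borel])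
  qed (auto intro!: integrable_const_bound[where B=1])
  finally show ?thesis by (simp add: sojourn[symmetric])
qed

locale exponential_clocks = prob_space M for M :: "'w measure" +
  fixes \<gamma> :: "nat \<Rightarrow> 'w \<Rightarrow> real"
  assumes exponential_clock: "1 \<le> k \<Longrightarrow> distributed M lborel (\<gamma> k) (exponential_density 1)"
    and indep_clocks: "indep_vars (\<lambda>_. borel) \<gamma> {1..}"
begin

definition ring_time :: "(nat \<Rightarrow> real) \<Rightarrow> nat \<Rightarrow> 'w \<Rightarrow> real" where
  "ring_time a k \<omega> = (\<Sum>i<k. \<gamma> (Suc i) \<omega> / a i)"

definition ring_cdf :: "(nat \<Rightarrow> real) \<Rightarrow> nat \<Rightarrow> real \<Rightarrow> real" where
  "ring_cdf a k s = prob {\<omega> \<in> space M. ring_time a k \<omega> \<le> s}"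

lemma measurable_clock [measurable]: "\<gamma> (Suc k) \<in> borel_measurable M"
  using distributed_measurable[OF exponential_clock[of "Suc k"]] by simp

lemma measurable_ring_time [measurable]: "ring_time a k \<in> borel_measurable M"
  unfolding ring_time_def by measurable

lemma AE_clocks_pos: "AE \<omega> in M. \<forall>k. 0 < \<gamma> (Suc k) \<omega>"
  by (simp add: AE_all_countable AE_exponential_pos[OF exponential_clock])

lemma AE_ring_time_nonneg:
  assumes "\<And>i. i < k \<Longrightarrow> 0 < a i"
  shows "AE \<omega> in M. 0 \<le> ring_time a k \<omega>"
  using AE_clocks_pos
  by eventually_elim (auto simp: ring_time_def intro!: sum_nonneg divide_nonneg_pos assms intro: less_imp_le)

lemma ring_time_Suc: "ring_time a (Suc k) \<omega> = ring_time a k \<omega> + \<gamma> (Suc k) \<omega> / a k"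
  by (simp add: ring_time_def)

lemma indep_ring_time_clock: "indep_var borel (ring_time a k) borel (\<gamma> (Suc k))"
proof -
  have "indep_var (PiM {1..k} (\<lambda>_. borel)) (\<lambda>\<omega>. restrict (\<lambda>i. \<gamma> i \<omega>) {1..k})
      (PiM {Suc k} (\<lambda>_. borel)) (\<lambda>\<omega>. restrict (\<lambda>i. \<gamma> i \<omega>) {Suc k})"
    by (rule indep_var_restrict[OF indep_clocks]) auto
  then have "indep_var
      borel ((\<lambda>g. \<Sum>i<k. g (Suc i) / a i) \<circ> (\<lambda>\<omega>. restrict (\<lambda>i. \<gamma> i \<omega>) {1..k}))
      borel ((\<lambda>g. g (Suc k)) \<circ> (\<lambda>\<omega>. restrict (\<lambda>i. \<gamma> i \<omega>) {Suc k}))"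
  proof (rule indep_var_compose)
    show "(\<lambda>g. \<Sum>i<k. g (Suc i) / a i) \<in> borel_measurable (PiM {1..k} (\<lambda>_. borel))"
      by (intro borel_measurable_sum borel_measurable_divide measurable_component_singleton) auto
  qed simp
  then show ?thesis
    by (simp add: comp_def ring_time_def[abs_def])
qed

lemma ring_cdf_cong: "(\<And>i. i < k \<Longrightarrow> a i = b i) \<Longrightarrow> ring_cdf a k s = ring_cdf b k s"
  by (simp add: ring_cdf_def ring_time_def)

lemma ring_cdf_nonneg: "0 \<le> ring_cdf a k s"
  by (simp add: ring_cdf_def)

lemma ring_cdf_le_1: "ring_cdf a k s \<le> 1"
  by (simp add: ring_cdf_def)

lemma ring_cdf_Suc_le:
  assumes "0 < a k"
  shows "ring_cdf a (Suc k) s \<le> ring_cdf a k s"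
  unfolding ring_cdf_def
proof (rule finite_measure_mono_AE)
  show "AE \<omega> in M. \<omega> \<in> {\<omega> \<in> space M. ring_time a (Suc k) \<omega> \<le> s} \<longrightarrow> \<omega> \<in> {\<omega> \<in> space M. ring_time a k \<omega> \<le> s}"
    using AE_clocks_pos
  proof eventually_elim
    case (elim \<omega>)
    then have "0 < \<gamma> (Suc k) \<omega> / a k" using assms by simp
    then show ?case by (auto simp: ring_time_Suc)
  qed
qed measurable

lemma ring_cdf_Suc:
  assumes "\<And>i. i \<le> k \<Longrightarrow> 0 < a i"
  shows "ring_cdf a (Suc k) s = a k * (LBINT r:{0..s}. ring_cdf a k r - ring_cdf a (Suc k) r)"
  unfolding ring_cdf_def ring_time_Suc using assms
  by (intro prob_add_exponential_le indep_ring_time_clock exponential_clock AE_ring_time_nonneg) auto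

lemma measurable_ring_cdf [measurable (raw)]:
  assumes [measurable]: "\<And>i. (\<lambda>x. a x i) \<in> borel_measurable N" "g \<in> borel_measurable N"
  shows "(\<lambda>x. ring_cdf (a x) k (g x)) \<in> borel_measurable N"
proof -
  have "ring_cdf (a x) k (g x) = expectation (\<lambda>\<omega>. if ring_time (a x) k \<omega> \<le> g x then 1 else 0)" for x
    using expectation_indicator_vimage[where N=borel and X="ring_time (a x) k" and A="{..g x}"]
    by (simp add: ring_cdf_def indicator_def of_bool_def)
  moreover have "(\<lambda>x. expectation (\<lambda>\<omega>. if ring_time (a x) k \<omega> \<le> g x then 1 else 0 :: real)) \<in> borel_measurable N"
    unfolding ring_time_def by measurable
  ultimately show ?thesis by simp
qed

lemma set_integrable_ring_cdf: "set_integrable lborel {0..s} (ring_cdf a k)"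
  by (rule set_integrable_lborel_bounded[where B=1]) (auto simp: ring_cdf_nonneg ring_cdf_le_1)

lemma ring_cdf_le_power_over_fact:
  assumes "\<And>i. i < k \<Longrightarrow> 0 < a i \<and> a i \<le> C" and "0 \<le> C" and "0 \<le> s"
  shows "ring_cdf a k s \<le> (C * s) ^ k / fact k"
  using assms
proof (induction k arbitrary: s)
  case 0
  show ?case using ring_cdf_le_1[of a 0 s] by simp
next
  case (Suc k)
  have "ring_cdf a (Suc k) s = a k * (LBINT r:{0..s}. ring_cdf a k r - ring_cdf a (Suc k) r)"
    using Suc.prems by (intro ring_cdf_Suc) (simp add: less_Suc_eq_le)
  also have "\<dots> \<le> C * (LBINT r:{0..s}. ring_cdf a k r)"
  proof (intro mult_mono set_integral_mono set_integral_diff set_integrable_ring_cdf)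
    show "0 \<le> (LBINT r:{0..s}. ring_cdf a k r - ring_cdf a (Suc k) r)"
      unfolding set_lebesgue_integral_def using Suc.prems
      by (intro Bochner_Integration.integral_nonneg) (simp add: ring_cdf_Suc_le)
  qed (use Suc.prems in \<open>auto simp: ring_cdf_nonneg\<close>)
  also have "\<dots> = (LBINT r:{0..s}. C * ring_cdf a k r)"
    by simp
  also have "\<dots> \<le> 1 * ((C * s) ^ Suc k / fact (Suc k))"
  proof (rule set_integral_le_power_over_fact)
    fix r :: real assume "0 \<le> r"
    then show "C * ring_cdf a k r \<le> 1 * (C * ((C * r) ^ k / fact k))"
      using Suc by (simp add: mult_left_mono del: times_divide_eq_right)
  qed (use Suc.prems set_integrable_ring_cdf in auto)
  finally show ?case by simp
qed

end

section \<open>Jump processes\<close>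

definition jump_generator :: "('s \<Rightarrow> real) \<Rightarrow> ('s \<Rightarrow> 's measure) \<Rightarrow> ('s \<Rightarrow> real) \<Rightarrow> 's \<Rightarrow> real" where
  "jump_generator c K f x = c x * ((\<integral>z. f z \<partial>K x) - f x)"

locale jump_process = exponential_clocks M \<gamma> for M :: "'w measure" and \<gamma> :: "nat \<Rightarrow> 'w \<Rightarrow> real" +
  fixes S :: "'s measure" and K :: "'s \<Rightarrow> 's measure" and c :: "'s \<Rightarrow> real" and C :: real
    and Y :: "nat \<Rightarrow> 'w \<Rightarrow> 's"
  assumes kernel [measurable]: "K \<in> S \<rightarrow>\<^sub>M prob_algebra S"
    and measurable_rate [measurable]: "c \<in> borel_measurable S"
    and rate_pos: "\<And>x. x \<in> space S \<Longrightarrow> 0 < c x"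
    and rate_le: "\<And>x. x \<in> space S \<Longrightarrow> c x \<le> C"
    and measurable_chain [measurable]: "\<And>k. Y k \<in> M \<rightarrow>\<^sub>M S"
    and markov: "\<And>k B. (\<And>j. B j \<in> sets S) \<Longrightarrow> prob {\<omega> \<in> space M. \<forall>j\<le>Suc k. Y j \<omega> \<in> B j}
      = (\<integral>\<omega>. indicator {\<omega> \<in> space M. \<forall>j\<le>k. Y j \<omega> \<in> B j} \<omega> * measure (K (Y k \<omega>)) (B (Suc k)) \<partial>M)"
    and indep_chain_clocks: "indep_set
      {(\<lambda>\<omega> k. Y k \<omega>) -` A \<inter> space M | A. A \<in> sets (PiM UNIV (\<lambda>_. S))}
      {(\<lambda>\<omega>. restrict (\<lambda>k. \<gamma> k \<omega>) {1..}) -` A \<inter> space M | A. A \<in> sets (PiM {1..} (\<lambda>_. borel))}"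
begin

lemma chain_in_space: "\<omega> \<in> space M \<Longrightarrow> Y k \<omega> \<in> space S"
  by (rule measurable_space[OF measurable_chain])

lemma kernel_subprob [measurable]: "K \<in> S \<rightarrow>\<^sub>M subprob_algebra S"
  by (rule measurable_prob_algebraD[OF kernel])

lemma prob_space_kernel: "x \<in> space S \<Longrightarrow> prob_space (K x)"
  and sets_kernel: "x \<in> space S \<Longrightarrow> sets (K x) = sets S"
  using measurable_space[OF kernel] by (auto simp: space_prob_algebra)

lemma borel_measurable_kernel: "x \<in> space S \<Longrightarrow> borel_measurable (K x) = borel_measurable S"
  by (rule measurable_cong_sets[OF sets_kernel refl])

lemma rate_bound_nonneg: "0 \<le> C"
proof -
  obtain \<omega> where "\<omega> \<in> space M" using not_empty by blast
  from rate_pos[OF chain_in_space[OF this]] rate_le[OF chain_in_space[OF this]] show ?thesis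
    by (rule less_imp_le[OF less_le_trans])
qed

subsection \<open>The Markov property\<close>

definition past :: "nat \<Rightarrow> 'w \<Rightarrow> nat \<Rightarrow> 's" where
  "past k \<omega> = restrict (\<lambda>j. Y j \<omega>) {..k}"

lemma measurable_past [measurable]: "past k \<in> M \<rightarrow>\<^sub>M PiM {..k} (\<lambda>_. S)"
  unfolding past_def by measurable

lemma nn_integral_markov_box:
  assumes sets_A: "\<And>j. j \<le> k \<Longrightarrow> A j \<in> sets S" and [measurable]: "B \<in> sets S"
  defines "H \<equiv> {\<omega> \<in> space M. \<forall>j\<le>k. Y j \<omega> \<in> A j}"
  shows "(\<integral>\<^sup>+\<omega>. indicator B (Y (Suc k) \<omega>) * indicator H \<omega> \<partial>M) = (\<integral>\<^sup>+\<omega>. emeasure (K (Y k \<omega>)) B * indicator H \<omega> \<partial>M)"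
proof -
  define A' where "A' j = (if j \<le> k then A j else B)" for j
  have A' [measurable]: "A' j \<in> sets S" for j
    using sets_A by (auto simp: A'_def)
  have H: "H = {\<omega> \<in> space M. \<forall>j\<le>k. Y j \<omega> \<in> A' j}"
    by (auto simp: H_def A'_def)
  then have [measurable]: "H \<in> sets M"
    by simp
  have "(\<integral>\<^sup>+\<omega>. indicator B (Y (Suc k) \<omega>) * indicator H \<omega> \<partial>M)
      = (\<integral>\<^sup>+\<omega>. indicator {\<omega> \<in> space M. \<forall>j\<le>Suc k. Y j \<omega> \<in> A' j} \<omega> \<partial>M)"
    by (intro nn_integral_cong) (auto simp: H A'_def le_Suc_eq split: split_indicator)
  also have "\<dots> = prob {\<omega> \<in> space M. \<forall>j\<le>Suc k. Y j \<omega> \<in> A' j}"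
    by (simp add: emeasure_eq_measure)
  also have "\<dots> = (\<integral>\<omega>. indicator H \<omega> * measure (K (Y k \<omega>)) B \<partial>M)"
    using markov[of A' k] A' by (simp add: H A'_def)
  also have "\<dots> = (\<integral>\<^sup>+\<omega>. ennreal (indicator H \<omega> * measure (K (Y k \<omega>)) B) \<partial>M)"
  proof (rule nn_integral_eq_integral[symmetric])
    show "integrable M (\<lambda>\<omega>. indicator H \<omega> * measure (K (Y k \<omega>)) B)"
      by (rule integrable_const_bound[where B=1])
         (auto intro!: prob_space.prob_le_1 prob_space_kernel chain_in_space split: split_indicator)
  qed simp
  also have "\<dots> = (\<integral>\<^sup>+\<omega>. emeasure (K (Y k \<omega>)) B * indicator H \<omega> \<partial>M)"
    by (intro nn_integral_cong)
       (auto simp: finite_measure.emeasure_eq_measure[OF prob_space.finite_measure]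
         prob_space_kernel chain_in_space split: split_indicator)
  finally show ?thesis .
qed

lemma markov_past:
  assumes [measurable]: "B \<in> sets S"
  shows "distr (density M (\<lambda>\<omega>. indicator B (Y (Suc k) \<omega>))) (PiM {..k} (\<lambda>_. S)) (past k)
       = distr (density M (\<lambda>\<omega>. emeasure (K (Y k \<omega>)) B)) (PiM {..k} (\<lambda>_. S)) (past k)"
    (is "?\<mu> = ?\<nu>")
proof (rule measure_eqI_PiM_finite)
  let ?P = "PiM {..k} (\<lambda>_. S)" and ?\<Omega> = "PiE {..k} (\<lambda>_. space S)"
  show "range (\<lambda>_::nat. ?\<Omega>) \<subseteq> prod_algebra {..k} (\<lambda>_. S)"
    by (auto intro!: prod_algebraI_finite)
  show "(\<Union>_::nat. ?\<Omega>) = space ?P"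
    by (simp add: space_PiM)
  have [measurable]: "?\<Omega> \<in> sets ?P"
    by (intro sets_PiM_I_finite) auto
  have "emeasure ?\<mu> ?\<Omega> \<le> (\<integral>\<^sup>+\<omega>. 1 \<partial>M)"
    by (simp add: emeasure_distr emeasure_density del: nn_integral_const)
       (intro nn_integral_mono, auto split: split_indicator)
  then show "emeasure ?\<mu> ?\<Omega> \<noteq> \<infinity>"
    by (auto simp: emeasure_space_1 top_unique)
  fix A assume sets_A: "\<And>i. i \<in> {..k} \<Longrightarrow> A i \<in> sets S"
  then have [measurable]: "PiE {..k} A \<in> sets ?P"
    by (intro sets_PiM_I_finite) auto
  have "past k -` PiE {..k} A \<inter> space M = {\<omega> \<in> space M. \<forall>j\<le>k. Y j \<omega> \<in> A j}"
    by (auto simp: past_def PiE_iff)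
  then show "emeasure ?\<mu> (PiE {..k} A) = emeasure ?\<nu> (PiE {..k} A)"
    using nn_integral_markov_box[of k A B] sets_A by (simp add: emeasure_distr emeasure_density)
qed simp_all

lemma distr_next_state_reweighted:
  assumes [measurable]: "Z \<in> borel_measurable (PiM {..k} (\<lambda>_. S))"
  shows "distr (density M (\<lambda>\<omega>. Z (past k \<omega>))) S (Y (Suc k)) = density M (\<lambda>\<omega>. Z (past k \<omega>)) \<bind> (\<lambda>\<omega>. K (Y k \<omega>))"
proof (rule measure_eqI)
  let ?D = "density M (\<lambda>\<omega>. Z (past k \<omega>))"
  have kernel_Y: "(\<lambda>\<omega>. K (Y k \<omega>)) \<in> ?D \<rightarrow>\<^sub>M subprob_algebra S"
    by simp
  have nonempty: "space ?D \<noteq> {}"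
    using not_empty by simp
  show "sets (distr ?D S (Y (Suc k))) = sets (?D \<bind> (\<lambda>\<omega>. K (Y k \<omega>)))"
    by (subst sets_bind[OF _ nonempty, where N=S]) (simp_all add: sets_kernel chain_in_space)
  fix B assume "B \<in> sets (distr ?D S (Y (Suc k)))"
  then have [measurable]: "B \<in> sets S" by simp
  have "emeasure (distr ?D S (Y (Suc k))) B = (\<integral>\<^sup>+\<omega>. indicator B (Y (Suc k) \<omega>) * Z (past k \<omega>) \<partial>M)"
    by (subst emeasure_distr) (auto simp: emeasure_density mult.commute intro!: nn_integral_cong split: split_indicator)
  also have "\<dots> = (\<integral>\<^sup>+p. Z p \<partial>distr (density M (\<lambda>\<omega>. indicator B (Y (Suc k) \<omega>))) (PiM {..k} (\<lambda>_. S)) (past k))"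
    by (simp add: nn_integral_distr nn_integral_density)
  also have "\<dots> = (\<integral>\<^sup>+\<omega>. emeasure (K (Y k \<omega>)) B * Z (past k \<omega>) \<partial>M)"
    unfolding markov_past[OF \<open>B \<in> sets S\<close>] by (simp add: nn_integral_distr nn_integral_density)
  also have "\<dots> = emeasure (?D \<bind> (\<lambda>\<omega>. K (Y k \<omega>))) B"
    by (simp add: emeasure_bind[OF nonempty kernel_Y] nn_integral_density mult.commute)
  finally show "emeasure (distr ?D S (Y (Suc k))) B = emeasure (?D \<bind> (\<lambda>\<omega>. K (Y k \<omega>))) B" .
qed

lemma nn_integral_markov:
  assumes [measurable]: "Z \<in> borel_measurable (PiM {..k} (\<lambda>_. S))" "f \<in> borel_measurable S"
  shows "(\<integral>\<^sup>+\<omega>. Z (past k \<omega>) * f (Y (Suc k) \<omega>) \<partial>M) = (\<integral>\<^sup>+\<omega>. Z (past k \<omega>) * (\<integral>\<^sup>+x. f x \<partial>K (Y k \<omega>)) \<partial>M)"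
proof -
  have "(\<integral>\<^sup>+\<omega>. Z (past k \<omega>) * f (Y (Suc k) \<omega>) \<partial>M)
      = (\<integral>\<^sup>+x. f x \<partial>distr (density M (\<lambda>\<omega>. Z (past k \<omega>))) S (Y (Suc k)))"
    by (simp add: nn_integral_distr nn_integral_density)
  also have "\<dots> = (\<integral>\<^sup>+\<omega>. Z (past k \<omega>) * (\<integral>\<^sup>+x. f x \<partial>K (Y k \<omega>)) \<partial>M)"
    unfolding distr_next_state_reweighted[OF assms(1)]
    by (simp add: nn_integral_bind[where B=S] nn_integral_density)
  finally show ?thesis .
qed

lemma integral_markov_nonneg:
  fixes Z :: "(nat \<Rightarrow> 's) \<Rightarrow> real" and f :: "'s \<Rightarrow> real"
  assumes [measurable]: "Z \<in> borel_measurable (PiM {..k} (\<lambda>_. S))" and Z_bounds: "\<And>p. 0 \<le> Z p \<and> Z p \<le> 1"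
    and [measurable]: "f \<in> borel_measurable S" and nonneg: "\<And>x. 0 \<le> f x"
    and integrable_f: "integrable M (\<lambda>\<omega>. f (Y (Suc k) \<omega>))"
    and integrable_K_f: "\<And>x. x \<in> space S \<Longrightarrow> integrable (K x) f"
  shows "integrable M (\<lambda>\<omega>. (\<integral>x. f x \<partial>K (Y k \<omega>)) * Z (past k \<omega>))"
    and "(\<integral>\<omega>. f (Y (Suc k) \<omega>) * Z (past k \<omega>) \<partial>M) = (\<integral>\<omega>. (\<integral>x. f x \<partial>K (Y k \<omega>)) * Z (past k \<omega>) \<partial>M)"
proof -
  have "(\<integral>\<^sup>+\<omega>. ennreal (f (Y (Suc k) \<omega>) * Z (past k \<omega>)) \<partial>M)
      = (\<integral>\<^sup>+\<omega>. ennreal (Z (past k \<omega>)) * (\<integral>\<^sup>+x. f x \<partial>K (Y k \<omega>)) \<partial>M)"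
    using nn_integral_markov[of "\<lambda>p. ennreal (Z p)" k "\<lambda>x. ennreal (f x)"] Z_bounds nonneg
    by (simp add: ennreal_mult mult.commute)
  also have "\<dots> = (\<integral>\<^sup>+\<omega>. ennreal ((\<integral>x. f x \<partial>K (Y k \<omega>)) * Z (past k \<omega>)) \<partial>M)"
    by (intro nn_integral_cong)
       (simp add: ennreal_mult mult.commute Z_bounds nonneg nn_integral_eq_integral[OF integrable_K_f] chain_in_space)
  finally have nn_eq: "(\<integral>\<^sup>+\<omega>. ennreal (f (Y (Suc k) \<omega>) * Z (past k \<omega>)) \<partial>M)
      = (\<integral>\<^sup>+\<omega>. ennreal ((\<integral>x. f x \<partial>K (Y k \<omega>)) * Z (past k \<omega>)) \<partial>M)" .
  have "integrable M (\<lambda>\<omega>. f (Y (Suc k) \<omega>) * Z (past k \<omega>))"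
    using Z_bounds by (intro integrable_mult_abs_le_1 integrable_f) auto
  then show "integrable M (\<lambda>\<omega>. (\<integral>x. f x \<partial>K (Y k \<omega>)) * Z (past k \<omega>))"
    using Z_bounds nonneg nn_eq by (intro integrableI_nonneg) (auto simp: integrable_iff_bounded)
  show "(\<integral>\<omega>. f (Y (Suc k) \<omega>) * Z (past k \<omega>) \<partial>M) = (\<integral>\<omega>. (\<integral>x. f x \<partial>K (Y k \<omega>)) * Z (past k \<omega>) \<partial>M)"
    using Z_bounds nonneg by (simp add: integral_eq_nn_integral nn_eq)
qed

lemma integral_markov:
  fixes Z :: "(nat \<Rightarrow> 's) \<Rightarrow> real" and f :: "'s \<Rightarrow> real"
  assumes Z_meas [measurable]: "Z \<in> borel_measurable (PiM {..k} (\<lambda>_. S))" and Z_bounds: "\<And>p. 0 \<le> Z p \<and> Z p \<le> 1"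
    and [measurable]: "f \<in> borel_measurable S"
    and integrable_f: "integrable M (\<lambda>\<omega>. f (Y (Suc k) \<omega>))"
    and integrable_K_f: "\<And>x. x \<in> space S \<Longrightarrow> integrable (K x) f"
  shows "integrable M (\<lambda>\<omega>. (\<integral>x. f x \<partial>K (Y k \<omega>)) * Z (past k \<omega>))"
    and "(\<integral>\<omega>. f (Y (Suc k) \<omega>) * Z (past k \<omega>) \<partial>M) = (\<integral>\<omega>. (\<integral>x. f x \<partial>K (Y k \<omega>)) * Z (past k \<omega>) \<partial>M)"
proof -
  let ?fpos = "\<lambda>x. max 0 (f x)" and ?fneg = "\<lambda>x. max 0 (- f x)"
  have f_eq: "?fpos x - ?fneg x = f x" for x by simp
  have measurable_parts: "?fpos \<in> borel_measurable S" "?fneg \<in> borel_measurable S"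
    by measurable
  have integrable_parts: "integrable M (\<lambda>\<omega>. ?fpos (Y (Suc k) \<omega>))" "integrable M (\<lambda>\<omega>. ?fneg (Y (Suc k) \<omega>))"
    using integrable_f by auto
  have integrable_K_parts: "integrable (K x) ?fpos" "integrable (K x) ?fneg" if "x \<in> space S" for x
    using integrable_K_f[OF that] by auto
  note positive_part = integral_markov_nonneg[OF Z_meas Z_bounds measurable_parts(1) max.cobounded1 integrable_parts(1) integrable_K_parts(1)]
    and negative_part = integral_markov_nonneg[OF Z_meas Z_bounds measurable_parts(2) max.cobounded1 integrable_parts(2) integrable_K_parts(2)]
  have kernel_parts: "(\<integral>x. ?fpos x \<partial>K (Y k \<omega>)) * Z (past k \<omega>) - (\<integral>x. ?fneg x \<partial>K (Y k \<omega>)) * Z (past k \<omega>)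
      = (\<integral>x. f x \<partial>K (Y k \<omega>)) * Z (past k \<omega>)" if "\<omega> \<in> space M" for \<omega>
    using integrable_K_parts[OF chain_in_space[OF that]]
    by (subst left_diff_distrib[symmetric], subst Bochner_Integration.integral_diff[symmetric]) (simp_all only: f_eq)
  show "integrable M (\<lambda>\<omega>. (\<integral>x. f x \<partial>K (Y k \<omega>)) * Z (past k \<omega>))"
    using Bochner_Integration.integrable_diff[OF positive_part(1) negative_part(1)]
    by (rule Bochner_Integration.integrable_cong[THEN iffD1, rotated 2]) (use kernel_parts in auto)
  have "(\<integral>\<omega>. f (Y (Suc k) \<omega>) * Z (past k \<omega>) \<partial>M)
      = (\<integral>\<omega>. ?fpos (Y (Suc k) \<omega>) * Z (past k \<omega>) - ?fneg (Y (Suc k) \<omega>) * Z (past k \<omega>) \<partial>M)"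
    by (simp only: left_diff_distrib[symmetric] f_eq)
  also have "\<dots> = (\<integral>\<omega>. ?fpos (Y (Suc k) \<omega>) * Z (past k \<omega>) \<partial>M) - (\<integral>\<omega>. ?fneg (Y (Suc k) \<omega>) * Z (past k \<omega>) \<partial>M)"
    using Z_bounds by (intro Bochner_Integration.integral_diff integrable_mult_abs_le_1 integrable_parts) auto
  also have "\<dots> = (\<integral>\<omega>. (\<integral>x. ?fpos x \<partial>K (Y k \<omega>)) * Z (past k \<omega>) - (\<integral>x. ?fneg x \<partial>K (Y k \<omega>)) * Z (past k \<omega>) \<partial>M)"
    by (simp only: positive_part(2) negative_part(2)
        Bochner_Integration.integral_diff[OF positive_part(1) negative_part(1)])
  also have "\<dots> = (\<integral>\<omega>. (\<integral>x. f x \<partial>K (Y k \<omega>)) * Z (past k \<omega>) \<partial>M)"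
    by (intro Bochner_Integration.integral_cong refl kernel_parts)
  finally show "(\<integral>\<omega>. f (Y (Suc k) \<omega>) * Z (past k \<omega>) \<partial>M) = (\<integral>\<omega>. (\<integral>x. f x \<partial>K (Y k \<omega>)) * Z (past k \<omega>) \<partial>M)" .
qed

subsection \<open>The jump construction\<close>

definition arrival_time :: "nat \<Rightarrow> 'w \<Rightarrow> real" where
  "arrival_time k \<omega> = ring_time (\<lambda>i. c (Y i \<omega>)) k \<omega>"

definition state_at :: "real \<Rightarrow> 'w \<Rightarrow> 's" where
  "state_at s \<omega> = Y (LEAST k. arrival_time k \<omega> \<le> s \<and> s < arrival_time (Suc k) \<omega>) \<omega>"

text \<open>The clocks are independent of the chain, so this is the conditional probability of
  \<open>arrival_time k \<le> s\<close> given the chain.\<close>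

definition arrival_prob :: "nat \<Rightarrow> real \<Rightarrow> 'w \<Rightarrow> real" where
  "arrival_prob k s \<omega> = ring_cdf (\<lambda>i. c (Y i \<omega>)) k s"

lemma measurable_arrival_time [measurable]: "arrival_time k \<in> borel_measurable M"
  unfolding arrival_time_def ring_time_def by measurable

lemma measurable_state_at [measurable (raw)]:
  assumes [measurable]: "f \<in> N \<rightarrow>\<^sub>M M" "g \<in> borel_measurable N"
  shows "(\<lambda>x. state_at (g x) (f x)) \<in> N \<rightarrow>\<^sub>M S"
  unfolding state_at_def
  by (rule measurable_compose_countable[where f="\<lambda>k x. Y k (f x)"]) measurable

lemma state_at_in_space: "\<omega> \<in> space M \<Longrightarrow> state_at s \<omega> \<in> space S"
  by (simp add: state_at_def chain_in_space)

lemma measurable_arrival_prob [measurable (raw)]: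
  assumes [measurable]: "f \<in> N \<rightarrow>\<^sub>M M" "g \<in> borel_measurable N"
  shows "(\<lambda>x. arrival_prob k (g x) (f x)) \<in> borel_measurable N"
  unfolding arrival_prob_def by measurable

lemma arrival_prob_nonneg: "0 \<le> arrival_prob k s \<omega>"
  by (simp add: arrival_prob_def ring_cdf_nonneg)

lemma arrival_prob_le_1: "arrival_prob k s \<omega> \<le> 1"
  by (simp add: arrival_prob_def ring_cdf_le_1)

lemma arrival_prob_Suc_le: "\<omega> \<in> space M \<Longrightarrow> arrival_prob (Suc k) s \<omega> \<le> arrival_prob k s \<omega>"
  by (simp add: arrival_prob_def ring_cdf_Suc_le rate_pos chain_in_space)

lemma arrival_prob_0: "0 \<le> s \<Longrightarrow> arrival_prob 0 s \<omega> = 1"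
  by (simp add: arrival_prob_def ring_cdf_def ring_time_def prob_space)

lemma arrival_prob_Suc:
  "\<omega> \<in> space M \<Longrightarrow> arrival_prob (Suc k) s \<omega>
    = c (Y k \<omega>) * (LBINT r:{0..s}. arrival_prob k r \<omega> - arrival_prob (Suc k) r \<omega>)"
  unfolding arrival_prob_def by (rule ring_cdf_Suc) (simp add: rate_pos chain_in_space)

lemma arrival_prob_le_power_over_fact:
  assumes "\<omega> \<in> space M" "0 \<le> s"
  shows "arrival_prob k s \<omega> \<le> (C * s) ^ k / fact k"
  unfolding arrival_prob_def using assms
  by (intro ring_cdf_le_power_over_fact rate_bound_nonneg) (auto simp: rate_pos rate_le chain_in_space)

lemma integral_chain_clocks:
  fixes f :: "(nat \<Rightarrow> 's) \<times> (nat \<Rightarrow> real) \<Rightarrow> real"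
  assumes f: "f \<in> borel_measurable (PiM UNIV (\<lambda>_. S) \<Otimes>\<^sub>M PiM {1..} (\<lambda>_. borel))"
    and integrable_joint: "integrable M (\<lambda>\<omega>. f (\<lambda>k. Y k \<omega>, restrict (\<lambda>k. \<gamma> k \<omega>) {1..}))"
  shows "(\<integral>\<omega>. f (\<lambda>k. Y k \<omega>, restrict (\<lambda>k. \<gamma> k \<omega>) {1..}) \<partial>M)
    = (\<integral>\<omega>. \<integral>\<omega>'. f (\<lambda>k. Y k \<omega>, restrict (\<lambda>k. \<gamma> k \<omega>') {1..}) \<partial>M \<partial>M)"
proof -
  have chain: "(\<lambda>\<omega> k. Y k \<omega>) \<in> M \<rightarrow>\<^sub>M PiM UNIV (\<lambda>_. S)"
    by (rule measurable_PiM_single') (auto simp: chain_in_space)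
  have clocks: "(\<lambda>\<omega>. restrict (\<lambda>k. \<gamma> k \<omega>) {1..}) \<in> M \<rightarrow>\<^sub>M PiM {1..} (\<lambda>_. borel)"
    using distributed_measurable[OF exponential_clock] by (intro measurable_restrict) auto
  show ?thesis
    by (rule integral_of_product_law[OF chain clocks _ f integrable_joint])
       (rule distr_Pair_indep_set[OF chain clocks indep_chain_clocks])
qed

lemma expectation_arrival:
  fixes z :: "(nat \<Rightarrow> 's) \<Rightarrow> real"
  assumes [measurable]: "z \<in> borel_measurable (PiM UNIV (\<lambda>_. S))" and integrable_z: "integrable M (\<lambda>\<omega>. z (\<lambda>k. Y k \<omega>))"
  shows "(\<integral>\<omega>. z (\<lambda>k. Y k \<omega>) * indicator {..s} (arrival_time k \<omega>) \<partial>M)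
    = (\<integral>\<omega>. z (\<lambda>k. Y k \<omega>) * arrival_prob k s \<omega> \<partial>M)"
proof -
  define f where "f = (\<lambda>(p, g). z p * (if (\<Sum>i<k. g (Suc i) / c (p i)) \<le> s then 1 else 0))"
  have f_eq: "f (\<lambda>k. Y k \<omega>, restrict (\<lambda>k. \<gamma> k \<omega>') {1..})
      = z (\<lambda>k. Y k \<omega>) * indicator {..s} (ring_time (\<lambda>i. c (Y i \<omega>)) k \<omega>')" for \<omega> \<omega>'
    by (simp add: f_def ring_time_def indicator_def)
  have f_diagonal: "f (\<lambda>k. Y k \<omega>, restrict (\<lambda>k. \<gamma> k \<omega>) {1..}) = z (\<lambda>k. Y k \<omega>) * indicator {..s} (arrival_time k \<omega>)" for \<omega>
    by (simp only: f_eq arrival_time_def)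
  have [measurable]: "(\<lambda>x. snd x (Suc i)) \<in> borel_measurable (PiM UNIV (\<lambda>_. S) \<Otimes>\<^sub>M PiM {1..} (\<lambda>_. borel :: real measure))" for i
    by (rule measurable_compose[OF measurable_snd measurable_component_singleton]) simp
  have "f \<in> borel_measurable (PiM UNIV (\<lambda>_. S) \<Otimes>\<^sub>M PiM {1..} (\<lambda>_. borel))"
    unfolding f_def by measurable
  moreover have "integrable M (\<lambda>\<omega>. z (\<lambda>k. Y k \<omega>) * indicator {..s} (arrival_time k \<omega>))"
    by (rule integrable_mult_abs_le_1[OF integrable_z]) (auto simp: indicator_def)
  ultimately have "(\<integral>\<omega>. z (\<lambda>k. Y k \<omega>) * indicator {..s} (arrival_time k \<omega>) \<partial>M)
      = (\<integral>\<omega>. \<integral>\<omega>'. f (\<lambda>k. Y k \<omega>, restrict (\<lambda>k. \<gamma> k \<omega>') {1..}) \<partial>M \<partial>M)"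
    unfolding f_diagonal[symmetric] by (rule integral_chain_clocks)
  also have "\<dots> = (\<integral>\<omega>. z (\<lambda>k. Y k \<omega>) * arrival_prob k s \<omega> \<partial>M)"
    unfolding f_eq by (simp add: arrival_prob_def ring_cdf_def expectation_indicator_vimage[where N=borel and A="{..s}"])
  finally show ?thesis .
qed

lemma AE_arrival_time_strict_mono: "AE \<omega> in M. strict_mono (\<lambda>k. arrival_time k \<omega>)"
  using AE_clocks_pos AE_space
  by eventually_elim
     (auto intro!: strict_monoI_Suc divide_pos_pos rate_pos chain_in_space simp: arrival_time_def ring_time_Suc)

lemma prob_arrival_time_le:
  assumes "0 \<le> s"
  shows "prob {\<omega> \<in> space M. arrival_time k \<omega> \<le> s} \<le> (C * s) ^ k / fact k"
proof -
  have "prob {\<omega> \<in> space M. arrival_time k \<omega> \<le> s} = (\<integral>\<omega>. 1 * indicator {..s} (arrival_time k \<omega>) \<partial>M)"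
    by (simp add: expectation_indicator_vimage[where N=borel and A="{..s}"])
  also have "\<dots> = (\<integral>\<omega>. 1 * arrival_prob k s \<omega> \<partial>M)"
    by (rule expectation_arrival[of "\<lambda>_. 1"]) auto
  also have "\<dots> \<le> (C * s) ^ k / fact k"
  proof (rule integral_le_const)
    show "integrable M (\<lambda>\<omega>. 1 * arrival_prob k s \<omega>)"
      by (rule integrable_const_bound[where B=1]) (simp_all add: arrival_prob_nonneg arrival_prob_le_1)
  qed (simp add: arrival_prob_le_power_over_fact assms)
  finally show ?thesis .
qed

lemma AE_no_explosion:
  assumes "0 \<le> s"
  shows "AE \<omega> in M. \<exists>k. s < arrival_time k \<omega>"
proof -
  let ?E = "{\<omega> \<in> space M. \<forall>k. arrival_time k \<omega> \<le> s}"
  have "prob ?E \<le> (C * s) ^ k / fact k" for k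
    by (rule order_trans[OF finite_measure_mono prob_arrival_time_le[OF assms]]) auto
  then have "prob ?E \<le> 0"
    by (intro LIMSEQ_le_const[OF power_over_fact_tendsto_0]) auto
  then have "AE \<omega> in M. \<omega> \<notin> ?E"
    by (subst prob_eq_0[symmetric]) (auto intro: antisym)
  with AE_space show ?thesis
    by eventually_elim (auto simp: not_le)
qed

definition sojourn :: "nat \<Rightarrow> real \<Rightarrow> 'w \<Rightarrow> real" where
  "sojourn k s \<omega> = indicator {..s} (arrival_time k \<omega>) - indicator {..s} (arrival_time (Suc k) \<omega>)"

lemma measurable_sojourn [measurable]: "sojourn k s \<in> borel_measurable M"
  unfolding sojourn_def by measurable

lemma abs_sojourn_le_1: "\<bar>sojourn k s \<omega>\<bar> \<le> 1"
  by (auto simp: sojourn_def indicator_def)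

lemma AE_abs_sojourn_le: "AE \<omega> in M. \<bar>sojourn k s \<omega>\<bar> \<le> indicator {..s} (arrival_time k \<omega>)"
  using AE_arrival_time_strict_mono
proof eventually_elim
  case (elim \<omega>)
  then have "arrival_time k \<omega> < arrival_time (Suc k) \<omega>"
    by (simp add: strict_mono_Suc_iff)
  then show ?case
    by (auto simp: sojourn_def indicator_def)
qed

lemma AE_sojourn_eq:
  assumes "0 \<le> s"
  shows "AE \<omega> in M. \<exists>k. state_at s \<omega> = Y k \<omega> \<and> (\<forall>i. sojourn i s \<omega> = (if i = k then 1 else 0))"
  using AE_arrival_time_strict_mono AE_no_explosion[OF assms]
proof eventually_elim
  case (elim \<omega>)
  let ?t = "\<lambda>k. arrival_time k \<omega>"
  define m where "m = (LEAST m. s < ?t m)"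
  have s_less: "s < ?t m"
    unfolding m_def using elim(2) by (rule LeastI_ex)
  moreover have "?t 0 \<le> s"
    using assms by (simp add: arrival_time_def ring_time_def)
  ultimately obtain k where m: "m = Suc k"
    by (cases m) auto
  have "?t k \<le> s"
    using not_less_Least[of k "\<lambda>m. s < ?t m"] m by (auto simp: m_def)
  with s_less m have t_le_s: "?t i \<le> s \<longleftrightarrow> i \<le> k" for i
    using strict_mono_less_eq[OF elim(1), of i k] strict_mono_less_eq[OF elim(1), of "Suc k" i] by fastforce
  have "(LEAST i. ?t i \<le> s \<and> s < ?t (Suc i)) = k"
    by (rule Least_equality) (auto simp: t_le_s not_le[symmetric])
  then have "state_at s \<omega> = Y k \<omega>"
    by (simp add: state_at_def)
  moreover have "sojourn i s \<omega> = (if i = k then 1 else 0)" for i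
    by (auto simp: sojourn_def indicator_def t_le_s)
  ultimately show ?case
    by blast
qed

lemma AE_sojourn_sums:
  fixes f :: "'s \<Rightarrow> real"
  assumes "0 \<le> s"
  shows "AE \<omega> in M. (\<lambda>k. f (Y k \<omega>) * sojourn k s \<omega>) sums f (state_at s \<omega>)
    \<and> summable (\<lambda>k. norm (f (Y k \<omega>) * sojourn k s \<omega>))"
  using AE_sojourn_eq[OF assms]
proof eventually_elim
  case (elim \<omega>)
  then obtain k where "state_at s \<omega> = Y k \<omega>" and "\<And>i. sojourn i s \<omega> = (if i = k then 1 else 0)"
    by blast
  then have single: "f (Y i \<omega>) * sojourn i s \<omega> = (if i = k then f (state_at s \<omega>) else 0)" for i
    by simp
  show ?case
    unfolding single by (intro conjI sums_single summable_finite[of "{k}"]) auto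
qed

subsection \<open>Functions of geometric growth along the chain\<close>

definition lyapunov :: "('s \<Rightarrow> real) \<Rightarrow> real \<Rightarrow> bool" where
  "lyapunov V q \<longleftrightarrow> 0 \<le> q \<and> V \<in> borel_measurable S \<and> integrable M (\<lambda>\<omega>. V (Y 0 \<omega>))
    \<and> (\<forall>x\<in>space S. 0 \<le> V x \<and> (\<integral>\<^sup>+z. ennreal (V z) \<partial>K x) \<le> ennreal (q * V x))"

definition lyapunov_dominated :: "('s \<Rightarrow> real) \<Rightarrow> bool" where
  "lyapunov_dominated f \<longleftrightarrow> f \<in> borel_measurable S \<and> (\<exists>V q. lyapunov V q \<and> (\<forall>x\<in>space S. \<bar>f x\<bar> \<le> V x))"

lemma lyapunov_chain:
  assumes "lyapunov V q"
  shows "integrable M (\<lambda>\<omega>. V (Y k \<omega>)) \<and> (\<integral>\<omega>. V (Y k \<omega>) \<partial>M) \<le> (\<integral>\<omega>. V (Y 0 \<omega>) \<partial>M) * q ^ k"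
proof (induction k)
  case 0
  then show ?case using assms by (simp add: lyapunov_def)
next
  case (Suc k)
  have [measurable]: "V \<in> borel_measurable S" and q: "0 \<le> q"
    and V: "\<And>k \<omega>. \<omega> \<in> space M \<Longrightarrow> 0 \<le> V (Y k \<omega>)"
    and kernel_growth: "\<And>\<omega>. \<omega> \<in> space M \<Longrightarrow> (\<integral>\<^sup>+z. ennreal (V z) \<partial>K (Y k \<omega>)) \<le> ennreal (q * V (Y k \<omega>))"
    using assms chain_in_space by (auto simp: lyapunov_def)
  have "(\<integral>\<^sup>+\<omega>. ennreal (V (Y (Suc k) \<omega>)) \<partial>M) = (\<integral>\<^sup>+\<omega>. \<integral>\<^sup>+z. ennreal (V z) \<partial>K (Y k \<omega>) \<partial>M)"
    using nn_integral_markov[of "\<lambda>_. 1" k "\<lambda>x. ennreal (V x)"] by simp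
  also have "\<dots> \<le> (\<integral>\<^sup>+\<omega>. ennreal (q * V (Y k \<omega>)) \<partial>M)"
    by (intro nn_integral_mono kernel_growth)
  also have "\<dots> = ennreal (q * (\<integral>\<omega>. V (Y k \<omega>) \<partial>M))"
    using Suc q V by (subst nn_integral_eq_integral) auto
  finally have nn_integral_growth: "(\<integral>\<^sup>+\<omega>. ennreal (V (Y (Suc k) \<omega>)) \<partial>M) \<le> ennreal (q * (\<integral>\<omega>. V (Y k \<omega>) \<partial>M))" .
  then have integrable_Suc: "integrable M (\<lambda>\<omega>. V (Y (Suc k) \<omega>))"
    using V by (intro integrableI_nonneg) (auto simp: le_less_trans)
  have "0 \<le> q * (\<integral>\<omega>. V (Y k \<omega>) \<partial>M)"
    using q V by (intro mult_nonneg_nonneg Bochner_Integration.integral_nonneg) auto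
  with nn_integral_growth have "(\<integral>\<omega>. V (Y (Suc k) \<omega>) \<partial>M) \<le> q * (\<integral>\<omega>. V (Y k \<omega>) \<partial>M)"
    using V by (subst (asm) nn_integral_eq_integral[OF integrable_Suc]) auto
  also have "\<dots> \<le> q * ((\<integral>\<omega>. V (Y 0 \<omega>) \<partial>M) * q ^ k)"
    using Suc q by (intro mult_left_mono) auto
  finally show ?case using integrable_Suc by (simp add: mult_ac)
qed

lemma lyapunov_dominated_measurable: "lyapunov_dominated f \<Longrightarrow> f \<in> borel_measurable S"
  by (simp add: lyapunov_dominated_def)

lemma lyapunov_dominated_bounded:
  assumes "f \<in> borel_measurable S" and "\<And>x. x \<in> space S \<Longrightarrow> \<bar>f x\<bar> \<le> B"
  shows "lyapunov_dominated f"
proof -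
  have "lyapunov (\<lambda>_. \<bar>B\<bar>) 1"
    by (auto simp: lyapunov_def prob_space.emeasure_space_1 prob_space_kernel)
  with assms show ?thesis
    by (fastforce simp: lyapunov_dominated_def)
qed

lemma integrable_chain:
  assumes "lyapunov_dominated f"
  shows "integrable M (\<lambda>\<omega>. f (Y k \<omega>))"
proof -
  from assms obtain V q where "lyapunov V q" and dominated: "\<And>x. x \<in> space S \<Longrightarrow> \<bar>f x\<bar> \<le> V x"
    and [measurable]: "f \<in> borel_measurable S"
    by (auto simp: lyapunov_dominated_def)
  then show ?thesis
    by (intro Bochner_Integration.integrable_bound[OF conjunct1[OF lyapunov_chain]])
       (auto intro!: AE_I2 order_trans[OF dominated abs_ge_self] chain_in_space)
qed

lemma integrable_kernel:
  assumes "lyapunov_dominated f" and x: "x \<in> space S"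
  shows "integrable (K x) f"
proof -
  from assms obtain V q where V: "lyapunov V q" and dominated: "\<And>x. x \<in> space S \<Longrightarrow> \<bar>f x\<bar> \<le> V x"
    and f: "f \<in> borel_measurable S"
    by (auto simp: lyapunov_dominated_def)
  have space_K: "space (K x) = space S"
    using sets_kernel[OF x] by (rule sets_eq_imp_space_eq)
  have "integrable (K x) V"
    using V x by (intro integrableI_nonneg)
      (auto simp: lyapunov_def borel_measurable_kernel space_K le_less_trans)
  then show ?thesis
    by (rule Bochner_Integration.integrable_bound)
       (use f dominated in \<open>auto simp: borel_measurable_kernel[OF x] space_K intro!: AE_I2 order_trans[OF _ abs_ge_self]\<close>)
qed

lemma lyapunov_dominated_moment_bound:
  assumes "lyapunov_dominated f"
  obtains A q where "0 \<le> A" "\<And>k. (\<integral>\<omega>. \<bar>f (Y k \<omega>)\<bar> \<partial>M) \<le> A * q ^ k"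
proof -
  from assms obtain V q where V: "lyapunov V q" and dominated: "\<And>x. x \<in> space S \<Longrightarrow> \<bar>f x\<bar> \<le> V x"
    by (auto simp: lyapunov_dominated_def)
  show ?thesis
  proof (rule that)
    show "0 \<le> (\<integral>\<omega>. V (Y 0 \<omega>) \<partial>M)"
      using V by (intro Bochner_Integration.integral_nonneg) (simp add: lyapunov_def chain_in_space)
    fix k
    have "(\<integral>\<omega>. \<bar>f (Y k \<omega>)\<bar> \<partial>M) \<le> (\<integral>\<omega>. V (Y k \<omega>) \<partial>M)"
      using lyapunov_chain[OF V] dominated
      by (intro Bochner_Integration.integral_mono[OF integrable_abs[OF integrable_chain[OF assms]]])
         (auto simp: chain_in_space)
    with lyapunov_chain[OF V, of k] show "(\<integral>\<omega>. \<bar>f (Y k \<omega>)\<bar> \<partial>M) \<le> (\<integral>\<omega>. V (Y 0 \<omega>) \<partial>M) * q ^ k"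
      by simp
  qed
qed

lemma expectation_chain_arrival:
  assumes "lyapunov_dominated f"
  shows "(\<integral>\<omega>. f (Y m \<omega>) * indicator {..s} (arrival_time k \<omega>) \<partial>M) = (\<integral>\<omega>. f (Y m \<omega>) * arrival_prob k s \<omega> \<partial>M)"
proof -
  note [measurable] = lyapunov_dominated_measurable[OF assms]
  have "(\<lambda>p. f (p m)) \<in> borel_measurable (PiM UNIV (\<lambda>_. S))"
    by measurable
  then show ?thesis
    using expectation_arrival[of "\<lambda>p. f (p m)" s k] integrable_chain[OF assms] by simp
qed

lemma integrable_chain_indicator:
  "lyapunov_dominated f \<Longrightarrow> integrable M (\<lambda>\<omega>. f (Y m \<omega>) * indicator {..s} (arrival_time k \<omega>))"
  by (intro integrable_mult_abs_le_1 integrable_chain) (auto simp: indicator_def)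

lemma integrable_chain_arrival_prob:
  "lyapunov_dominated f \<Longrightarrow> integrable M (\<lambda>\<omega>. f (Y m \<omega>) * arrival_prob k s \<omega>)"
  by (intro integrable_mult_abs_le_1 integrable_chain) (auto simp: arrival_prob_nonneg arrival_prob_le_1)

lemma lyapunov_dominated_arrival_bound:
  assumes "lyapunov_dominated f" and s: "0 \<le> s"
  obtains A B where "\<And>k. (\<integral>\<omega>. \<bar>f (Y k \<omega>)\<bar> * arrival_prob k s \<omega> \<partial>M) \<le> A * (B ^ k / fact k)"
proof -
  obtain A q where "0 \<le> A" and moment_growth: "\<And>k. (\<integral>\<omega>. \<bar>f (Y k \<omega>)\<bar> \<partial>M) \<le> A * q ^ k"
    using lyapunov_dominated_moment_bound[OF assms(1)] by blast
  show ?thesis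
  proof (rule that)
    fix k
    have "(\<integral>\<omega>. \<bar>f (Y k \<omega>)\<bar> * arrival_prob k s \<omega> \<partial>M) \<le> (\<integral>\<omega>. \<bar>f (Y k \<omega>)\<bar> * ((C * s) ^ k / fact k) \<partial>M)"
      using s assms(1)
      by (intro Bochner_Integration.integral_mono mult_left_mono integrable_mult_left integrable_mult_abs_le_1
            integrable_abs integrable_chain arrival_prob_le_power_over_fact)
         (auto simp: arrival_prob_nonneg arrival_prob_le_1)
    also have "\<dots> \<le> A * q ^ k * ((C * s) ^ k / fact k)"
      using moment_growth[of k] s rate_bound_nonneg by (simp add: mult_right_mono del: times_divide_eq_right)
    also have "\<dots> = A * ((q * (C * s)) ^ k / fact k)"
      by (simp add: power_mult_distrib)
    finally show "(\<integral>\<omega>. \<bar>f (Y k \<omega>)\<bar> * arrival_prob k s \<omega> \<partial>M) \<le> A * ((q * (C * s)) ^ k / fact k)" .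
  qed
qed

lemma expectation_arrival_tendsto_0:
  assumes "lyapunov_dominated f" and "0 \<le> s"
  shows "(\<lambda>k. \<integral>\<omega>. f (Y k \<omega>) * arrival_prob k s \<omega> \<partial>M) \<longlonglongrightarrow> 0"
proof -
  obtain A B where series_bound: "\<And>k. (\<integral>\<omega>. \<bar>f (Y k \<omega>)\<bar> * arrival_prob k s \<omega> \<partial>M) \<le> A * (B ^ k / fact k)"
    using lyapunov_dominated_arrival_bound[OF assms] by blast
  show ?thesis
  proof (rule Lim_null_comparison)
    have "norm (\<integral>\<omega>. f (Y k \<omega>) * arrival_prob k s \<omega> \<partial>M) \<le> A * (B ^ k / fact k)" for k
      using order_trans[OF integral_norm_bound[of M "\<lambda>\<omega>. f (Y k \<omega>) * arrival_prob k s \<omega>"]] series_bound[of k]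
      by (simp add: abs_mult arrival_prob_nonneg)
    then show "\<forall>\<^sub>F k in sequentially. norm (\<integral>\<omega>. f (Y k \<omega>) * arrival_prob k s \<omega> \<partial>M) \<le> A * (B ^ k / fact k)"
      by simp
    show "(\<lambda>k. A * (B ^ k / fact k)) \<longlonglongrightarrow> 0"
      by (rule tendsto_mult_right_zero[OF power_over_fact_tendsto_0])
  qed
qed

lemma expectation_sojourn:
  assumes f: "lyapunov_dominated f"
  shows "(\<integral>\<omega>. f (Y k \<omega>) * sojourn k s \<omega> \<partial>M) = (\<integral>\<omega>. f (Y k \<omega>) * (arrival_prob k s \<omega> - arrival_prob (Suc k) s \<omega>) \<partial>M)"
  by (simp add: sojourn_def right_diff_distrib f expectation_chain_arrival
      integrable_chain_indicator integrable_chain_arrival_prob)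

lemma expectation_abs_sojourn_le:
  assumes f: "lyapunov_dominated f"
  shows "(\<integral>\<omega>. \<bar>f (Y k \<omega>) * sojourn k s \<omega>\<bar> \<partial>M) \<le> (\<integral>\<omega>. \<bar>f (Y k \<omega>)\<bar> * arrival_prob k s \<omega> \<partial>M)"
proof -
  have abs_f: "lyapunov_dominated (\<lambda>x. \<bar>f x\<bar>)"
    using f by (auto simp: lyapunov_dominated_def)
  have "(\<integral>\<omega>. \<bar>f (Y k \<omega>) * sojourn k s \<omega>\<bar> \<partial>M) \<le> (\<integral>\<omega>. \<bar>f (Y k \<omega>)\<bar> * indicator {..s} (arrival_time k \<omega>) \<partial>M)"
  proof (rule integral_mono_AE)
    show "AE \<omega> in M. \<bar>f (Y k \<omega>) * sojourn k s \<omega>\<bar> \<le> \<bar>f (Y k \<omega>)\<bar> * indicator {..s} (arrival_time k \<omega>)"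
      using AE_abs_sojourn_le[of k s] by eventually_elim (simp add: abs_mult mult_left_mono)
    show "integrable M (\<lambda>\<omega>. \<bar>f (Y k \<omega>) * sojourn k s \<omega>\<bar>)"
      by (intro integrable_abs integrable_mult_abs_le_1 integrable_chain f abs_sojourn_le_1) measurable
  qed (rule integrable_chain_indicator[OF abs_f])
  then show ?thesis
    by (simp only: expectation_chain_arrival[OF abs_f])
qed

lemma
  assumes f: "lyapunov_dominated f" and s: "0 \<le> s"
  shows integrable_state_at: "integrable M (\<lambda>\<omega>. f (state_at s \<omega>))"
    and expectation_state_at_sums: "(\<lambda>k. \<integral>\<omega>. f (Y k \<omega>) * (arrival_prob k s \<omega> - arrival_prob (Suc k) s \<omega>) \<partial>M)
      sums (\<integral>\<omega>. f (state_at s \<omega>) \<partial>M)"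
proof -
  note [measurable] = lyapunov_dominated_measurable[OF f]
  let ?h = "\<lambda>k \<omega>. f (Y k \<omega>) * sojourn k s \<omega>"
  have integrable_h: "integrable M (?h k)" for k
    by (intro integrable_mult_abs_le_1 integrable_chain f abs_sojourn_le_1) measurable
  have AE_summable: "AE \<omega> in M. summable (\<lambda>k. norm (?h k \<omega>))"
    and AE_suminf: "AE \<omega> in M. (\<Sum>k. ?h k \<omega>) = f (state_at s \<omega>)"
    using AE_sojourn_sums[OF s, of f] by (auto elim!: eventually_mono dest: sums_unique)
  obtain A B where "\<And>k. (\<integral>\<omega>. \<bar>f (Y k \<omega>)\<bar> * arrival_prob k s \<omega> \<partial>M) \<le> A * (B ^ k / fact k)"
    using lyapunov_dominated_arrival_bound[OF f s] by blast
  then have "norm (\<integral>\<omega>. norm (?h k \<omega>) \<partial>M) \<le> A * (B ^ k / fact k)" for k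
    using order_trans[OF expectation_abs_sojourn_le[OF f]] by simp
  then have summable: "summable (\<lambda>k. \<integral>\<omega>. norm (?h k \<omega>) \<partial>M)"
    by (rule summable_comparison_test'[rotated]) (intro summable_mult sums_summable[OF power_over_fact_sums_exp])
  show "integrable M (\<lambda>\<omega>. f (state_at s \<omega>))"
    using integrable_suminf[OF integrable_h AE_summable summable] integrable_cong_AE[OF _ _ AE_suminf] by simp
  have "(\<integral>\<omega>. (\<Sum>k. ?h k \<omega>) \<partial>M) = (\<integral>\<omega>. f (state_at s \<omega>) \<partial>M)"
    by (rule integral_cong_AE[OF _ _ AE_suminf]) measurable
  then show "(\<lambda>k. \<integral>\<omega>. f (Y k \<omega>) * (arrival_prob k s \<omega> - arrival_prob (Suc k) s \<omega>) \<partial>M)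
      sums (\<integral>\<omega>. f (state_at s \<omega>) \<partial>M)"
    using sums_integral[OF integrable_h AE_summable summable] by (simp add: expectation_sojourn[OF f])
qed

subsection \<open>Dynkin's formula and stationarity\<close>

abbreviation "generator \<equiv> jump_generator c K"

lemma measurable_generator [measurable]:
  assumes [measurable]: "f \<in> borel_measurable S"
  shows "generator f \<in> borel_measurable S"
  unfolding jump_generator_def by measurable

lemma expectation_next_state_arrival:
  assumes f: "lyapunov_dominated f"
  shows "integrable M (\<lambda>\<omega>. (\<integral>z. f z \<partial>K (Y k \<omega>)) * arrival_prob (Suc k) s \<omega>)"
    and "(\<integral>\<omega>. f (Y (Suc k) \<omega>) * arrival_prob (Suc k) s \<omega> \<partial>M)
       = (\<integral>\<omega>. (\<integral>z. f z \<partial>K (Y k \<omega>)) * arrival_prob (Suc k) s \<omega> \<partial>M)"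
proof -
  define Z where "Z p = ring_cdf (\<lambda>i. c (p (min i k))) (Suc k) s" for p
  have "(\<lambda>p. p (min i k)) \<in> PiM {..k} (\<lambda>_. S) \<rightarrow>\<^sub>M S" for i
    by (rule measurable_component_singleton) simp
  then have Z_meas: "Z \<in> borel_measurable (PiM {..k} (\<lambda>_. S))"
    unfolding Z_def by measurable
  have Z_bounds: "0 \<le> Z p \<and> Z p \<le> 1" for p
    by (simp add: Z_def ring_cdf_nonneg ring_cdf_le_1)
  have Z_past: "Z (past k \<omega>) = arrival_prob (Suc k) s \<omega>" for \<omega>
    unfolding Z_def arrival_prob_def past_def by (intro ring_cdf_cong) auto
  note markov_Z = integral_markov[OF Z_meas Z_bounds lyapunov_dominated_measurable[OF f] integrable_chain[OF f]
      integrable_kernel[OF f], unfolded Z_past]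
  show "integrable M (\<lambda>\<omega>. (\<integral>z. f z \<partial>K (Y k \<omega>)) * arrival_prob (Suc k) s \<omega>)"
    by (rule markov_Z(1))
  show "(\<integral>\<omega>. f (Y (Suc k) \<omega>) * arrival_prob (Suc k) s \<omega> \<partial>M)
       = (\<integral>\<omega>. (\<integral>z. f z \<partial>K (Y k \<omega>)) * arrival_prob (Suc k) s \<omega> \<partial>M)"
    by (rule markov_Z(2))
qed

lemma abs_mult_sojourn_prob_le:
  assumes \<omega>: "\<omega> \<in> space M" and "\<And>x. x \<in> space S \<Longrightarrow> \<bar>g x\<bar> \<le> B"
  shows "\<bar>g (Y k \<omega>) * (arrival_prob k r \<omega> - arrival_prob (Suc k) r \<omega>)\<bar> \<le> B * arrival_prob k r \<omega>"
proof -
  have "\<bar>g (Y k \<omega>)\<bar> \<le> B"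
    using assms chain_in_space by blast
  moreover have "\<bar>arrival_prob k r \<omega> - arrival_prob (Suc k) r \<omega>\<bar> \<le> arrival_prob k r \<omega>"
    using arrival_prob_Suc_le[OF \<omega>, of k r] arrival_prob_nonneg[of "Suc k" r \<omega>] by simp
  ultimately show ?thesis
    unfolding abs_mult by (intro mult_mono) auto
qed

lemma expectation_jump_increment:
  assumes f: "lyapunov_dominated f" and bounded: "\<And>x. x \<in> space S \<Longrightarrow> \<bar>generator f x\<bar> \<le> B"
  shows "(\<integral>\<omega>. f (Y (Suc k) \<omega>) * arrival_prob (Suc k) s \<omega> \<partial>M) - (\<integral>\<omega>. f (Y k \<omega>) * arrival_prob (Suc k) s \<omega> \<partial>M)
    = (LBINT r:{0..s}. \<integral>\<omega>. generator f (Y k \<omega>) * (arrival_prob k r \<omega> - arrival_prob (Suc k) r \<omega>) \<partial>M)"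
proof -
  note [measurable] = lyapunov_dominated_measurable[OF f]
  have "(\<integral>\<omega>. f (Y (Suc k) \<omega>) * arrival_prob (Suc k) s \<omega> \<partial>M) - (\<integral>\<omega>. f (Y k \<omega>) * arrival_prob (Suc k) s \<omega> \<partial>M)
      = (\<integral>\<omega>. (\<integral>z. f z \<partial>K (Y k \<omega>)) * arrival_prob (Suc k) s \<omega> - f (Y k \<omega>) * arrival_prob (Suc k) s \<omega> \<partial>M)"
    by (subst expectation_next_state_arrival(2)[OF f], rule Bochner_Integration.integral_diff[symmetric])
       (intro expectation_next_state_arrival(1) integrable_chain_arrival_prob f)+
  also have "\<dots> = (\<integral>\<omega>. (LBINT r:{0..s}. generator f (Y k \<omega>) * (arrival_prob k r \<omega> - arrival_prob (Suc k) r \<omega>)) \<partial>M)"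
  proof (intro Bochner_Integration.integral_cong refl)
    fix \<omega> assume "\<omega> \<in> space M"
    from arrival_prob_Suc[OF this, of k s]
    show "(\<integral>z. f z \<partial>K (Y k \<omega>)) * arrival_prob (Suc k) s \<omega> - f (Y k \<omega>) * arrival_prob (Suc k) s \<omega>
        = (LBINT r:{0..s}. generator f (Y k \<omega>) * (arrival_prob k r \<omega> - arrival_prob (Suc k) r \<omega>))"
      unfolding jump_generator_def set_integral_mult_right by (simp add: algebra_simps)
  qed
  also have "\<dots> = (LBINT r:{0..s}. \<integral>\<omega>. generator f (Y k \<omega>) * (arrival_prob k r \<omega> - arrival_prob (Suc k) r \<omega>) \<partial>M)"
  proof (rule expectation_set_lborel_integral)
    fix r \<omega> assume \<omega>: "\<omega> \<in> space M"
    have "0 \<le> B"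
      using order_trans[OF abs_ge_zero bounded[OF chain_in_space[OF \<omega>]]] .
    then show "\<bar>generator f (Y k \<omega>) * (arrival_prob k r \<omega> - arrival_prob (Suc k) r \<omega>)\<bar> \<le> B"
      using order_trans[OF abs_mult_sojourn_prob_le[OF \<omega> bounded] mult_left_le[OF arrival_prob_le_1]] by simp
  qed measurable
  finally show ?thesis .
qed

lemma set_integral_expectation_state_at_sums:
  assumes g: "g \<in> borel_measurable S" and bounded: "\<And>x. x \<in> space S \<Longrightarrow> \<bar>g x\<bar> \<le> B"
  shows "(\<lambda>k. LBINT r:{0..s}. \<integral>\<omega>. g (Y k \<omega>) * (arrival_prob k r \<omega> - arrival_prob (Suc k) r \<omega>) \<partial>M)
    sums (LBINT r:{0..s}. \<integral>\<omega>. g (state_at r \<omega>) \<partial>M)"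
proof -
  note [measurable] = g
  define e where "e k r = (\<integral>\<omega>. g (Y k \<omega>) * (arrival_prob k r \<omega> - arrival_prob (Suc k) r \<omega>) \<partial>M)" for k r
  have "(\<lambda>k. LBINT r:{0..s}. e k r) sums (LBINT r:{0..s}. (\<Sum>k. e k r))"
  proof (rule set_lborel_integral_sums)
    show "e k \<in> borel_measurable borel" for k
      unfolding e_def by measurable
    show "summable (\<lambda>k. B * ((C * s) ^ k / fact k))"
      by (intro summable_mult sums_summable[OF power_over_fact_sums_exp])
    fix k r assume r: "0 \<le> r" "r \<le> s"
    have "norm (g (Y k \<omega>) * (arrival_prob k r \<omega> - arrival_prob (Suc k) r \<omega>)) \<le> B * ((C * s) ^ k / fact k)"
      if \<omega>: "\<omega> \<in> space M" for \<omega>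
    proof -
      have "arrival_prob k r \<omega> \<le> (C * r) ^ k / fact k"
        by (rule arrival_prob_le_power_over_fact[OF \<omega> r(1)])
      also have "\<dots> \<le> (C * s) ^ k / fact k"
        using r rate_bound_nonneg by (intro divide_right_mono power_mono mult_left_mono) auto
      finally have "B * arrival_prob k r \<omega> \<le> B * ((C * s) ^ k / fact k)"
        using order_trans[OF abs_ge_zero bounded[OF chain_in_space[OF \<omega>]]] by (rule mult_left_mono)
      moreover have "\<bar>g (Y k \<omega>) * (arrival_prob k r \<omega> - arrival_prob (Suc k) r \<omega>)\<bar> \<le> B * arrival_prob k r \<omega>"
        by (rule abs_mult_sojourn_prob_le[OF \<omega> bounded])
      ultimately show ?thesis
        by simp
    qed
    then show "\<bar>e k r\<bar> \<le> B * ((C * s) ^ k / fact k)"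
      unfolding e_def real_norm_def[symmetric]
      by (intro order_trans[OF integral_norm_bound] integral_le_const
          integrable_norm[OF integrable_const_bound[where B="B * ((C * s) ^ k / fact k)"]]) auto
  qed
  also have "(LBINT r:{0..s}. (\<Sum>k. e k r)) = (LBINT r:{0..s}. \<integral>\<omega>. g (state_at r \<omega>) \<partial>M)"
    unfolding e_def
    by (intro set_lebesgue_integral_cong)
       (auto intro!: sums_unique[symmetric] expectation_state_at_sums lyapunov_dominated_bounded[OF g bounded])
  finally show ?thesis
    unfolding e_def .
qed

theorem dynkin_formula:
  assumes f: "lyapunov_dominated f" and bounded: "\<And>x. x \<in> space S \<Longrightarrow> \<bar>generator f x\<bar> \<le> B"
    and s: "0 \<le> s"
  shows "(\<integral>\<omega>. f (state_at s \<omega>) \<partial>M)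
    = (\<integral>\<omega>. f (Y 0 \<omega>) \<partial>M) + (LBINT r:{0..s}. \<integral>\<omega>. generator f (state_at r \<omega>) \<partial>M)"
proof -
  note [measurable] = lyapunov_dominated_measurable[OF f]
  define u where "u k = (\<integral>\<omega>. f (Y k \<omega>) * arrival_prob k s \<omega> \<partial>M)" for k
  define w where "w k = (\<integral>\<omega>. f (Y k \<omega>) * arrival_prob (Suc k) s \<omega> \<partial>M)" for k
  have increment: "u (Suc k) - w k
      = (LBINT r:{0..s}. \<integral>\<omega>. generator f (Y k \<omega>) * (arrival_prob k r \<omega> - arrival_prob (Suc k) r \<omega>) \<partial>M)" for k
    unfolding u_def w_def by (rule expectation_jump_increment[OF f bounded])
  have "(\<lambda>k. u (Suc k) - w k) sums (LBINT r:{0..s}. \<integral>\<omega>. generator f (state_at r \<omega>) \<partial>M)"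
    unfolding increment by (rule set_integral_expectation_state_at_sums[OF _ bounded]) measurable
  then have "(\<lambda>K. u 0 - u K + (\<Sum>k<K. u (Suc k) - w k))
      \<longlonglongrightarrow> u 0 - 0 + (LBINT r:{0..s}. \<integral>\<omega>. generator f (state_at r \<omega>) \<partial>M)"
    unfolding sums_def using expectation_arrival_tendsto_0[OF f s] by (intro tendsto_intros) (simp_all add: u_def)
  moreover have "u 0 - u K + (\<Sum>k<K. u (Suc k) - w k) = (\<Sum>k<K. u k - w k)" for K
    by (induction K) auto
  moreover have "(\<lambda>K. \<Sum>k<K. u k - w k) \<longlonglongrightarrow> (\<integral>\<omega>. f (state_at s \<omega>) \<partial>M)"
    using expectation_state_at_sums[OF f s] integrable_chain_arrival_prob[OF f]
    by (simp add: sums_def u_def w_def right_diff_distrib)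
  ultimately have "(\<integral>\<omega>. f (state_at s \<omega>) \<partial>M) = u 0 + (LBINT r:{0..s}. \<integral>\<omega>. generator f (state_at r \<omega>) \<partial>M)"
    by (auto dest: LIMSEQ_unique)
  then show ?thesis
    by (simp add: u_def arrival_prob_0 s)
qed

lemma abs_generator_le:
  assumes f: "f \<in> borel_measurable S" and bounded: "\<And>x. x \<in> space S \<Longrightarrow> \<bar>f x\<bar> \<le> B" and x: "x \<in> space S"
  shows "\<bar>generator f x\<bar> \<le> 2 * C * B"
proof -
  interpret Kx: prob_space "K x" by (rule prob_space_kernel[OF x])
  have "space (K x) = space S"
    using sets_kernel[OF x] by (rule sets_eq_imp_space_eq)
  then have "\<bar>\<integral>z. f z \<partial>K x\<bar> \<le> B"
    using bounded integrable_kernel[OF lyapunov_dominated_bounded[OF f bounded] x]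
    by (intro order_trans[OF integral_abs_bound] Kx.integral_le_const) (auto intro!: AE_I2)
  then have "\<bar>(\<integral>z. f z \<partial>K x) - f x\<bar> \<le> 2 * B"
    using bounded[OF x] by linarith
  then have "c x * \<bar>(\<integral>z. f z \<partial>K x) - f x\<bar> \<le> C * (2 * B)"
    using rate_pos[OF x] rate_le[OF x] by (intro mult_mono) auto
  then show ?thesis
    using rate_pos[OF x] by (simp add: jump_generator_def abs_mult mult_ac)
qed

context
  fixes D :: "('s \<Rightarrow> real) set"
  assumes measurable_D: "\<And>h. h \<in> D \<Longrightarrow> h \<in> borel_measurable S"
    and bounded_D: "\<And>h. h \<in> D \<Longrightarrow> \<exists>B. \<forall>x\<in>space S. \<bar>h x\<bar> \<le> B"
    and generator_D: "\<And>h. h \<in> D \<Longrightarrow> generator h \<in> D"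
    and invariant_D: "\<And>h. h \<in> D \<Longrightarrow> (\<integral>\<omega>. generator h (Y 0 \<omega>) \<partial>M) = 0"
begin

definition deviation :: "('s \<Rightarrow> real) \<Rightarrow> real \<Rightarrow> real" where
  "deviation h s = (\<integral>\<omega>. h (state_at s \<omega>) \<partial>M) - (\<integral>\<omega>. h (Y 0 \<omega>) \<partial>M)"

lemma abs_deviation_le:
  assumes "h \<in> D" and bounded: "\<And>x. x \<in> space S \<Longrightarrow> \<bar>h x\<bar> \<le> B"
  shows "\<bar>deviation h s\<bar> \<le> 2 * B"
proof -
  have [measurable]: "h \<in> borel_measurable S" by (rule measurable_D) fact
  have abs_expectation_le: "\<bar>\<integral>\<omega>. h (Z \<omega>) \<partial>M\<bar> \<le> B" if [measurable]: "Z \<in> M \<rightarrow>\<^sub>M S" for Z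
  proof -
    have "\<bar>h (Z \<omega>)\<bar> \<le> B" if "\<omega> \<in> space M" for \<omega>
      by (rule bounded[OF measurable_space[OF \<open>Z \<in> M \<rightarrow>\<^sub>M S\<close> that]])
    then show ?thesis
      by (intro order_trans[OF integral_abs_bound] integral_le_const integrable_abs
          integrable_const_bound[where B=B]) auto
  qed
  have "state_at s \<in> M \<rightarrow>\<^sub>M S" by measurable
  from abs_expectation_le[OF this] abs_expectation_le[OF measurable_chain[of 0]] show ?thesis
    unfolding deviation_def by simp
qed

lemma deviation_eq_set_integral:
  assumes "h \<in> D" and bounded: "\<And>x. x \<in> space S \<Longrightarrow> \<bar>h x\<bar> \<le> B" and "0 \<le> s"
  shows "deviation h s = (LBINT r:{0..s}. deviation (generator h) r)"
  using dynkin_formula[OF lyapunov_dominated_bounded[OF measurable_D[OF assms(1)] bounded]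
      abs_generator_le[OF measurable_D[OF assms(1)] bounded] \<open>0 \<le> s\<close>] invariant_D[OF \<open>h \<in> D\<close>]
  by (simp add: deviation_def)

lemma abs_deviation_le_power_over_fact:
  assumes "h \<in> D" and "\<And>x. x \<in> space S \<Longrightarrow> \<bar>h x\<bar> \<le> B" and "0 \<le> s"
  shows "\<bar>deviation h s\<bar> \<le> 2 * B * ((2 * C * s) ^ k / fact k)"
  using assms
proof (induction k arbitrary: h B s)
  case 0
  then show ?case using abs_deviation_le by simp
next
  case (Suc k)
  have generator_in_D: "generator h \<in> D"
    by (rule generator_D) fact
  have abs_generator_h_le: "\<bar>generator h x\<bar> \<le> 2 * C * B" if "x \<in> space S" for x
    by (rule abs_generator_le[OF measurable_D[OF \<open>h \<in> D\<close>] Suc.prems(2) that])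
  have [measurable]: "generator h \<in> borel_measurable S"
    by (rule measurable_D[OF generator_in_D])
  have integrable_deviation: "set_integrable lborel {0..s} (deviation (generator h))"
  proof (rule set_integrable_lborel_bounded)
    show "deviation (generator h) \<in> borel_measurable borel"
      unfolding deviation_def by measurable
    show "\<bar>deviation (generator h) r\<bar> \<le> 2 * (2 * C * B)" for r
      by (rule abs_deviation_le[OF generator_in_D abs_generator_h_le])
  qed
  have "deviation h s = (LBINT r:{0..s}. deviation (generator h) r)"
    by (rule deviation_eq_set_integral[OF Suc.prems])
  then have "\<bar>deviation h s\<bar> \<le> (LBINT r:{0..s}. \<bar>deviation (generator h) r\<bar>)"
    using set_integral_norm_bound[OF integrable_deviation] by simp
  also have "\<dots> \<le> 2 * B * ((2 * C * s) ^ Suc k / fact (Suc k))"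
  proof (rule set_integral_le_power_over_fact[OF \<open>0 \<le> s\<close> set_integrable_abs[OF integrable_deviation]])
    fix r :: real assume "0 \<le> r"
    then have "\<bar>deviation (generator h) r\<bar> \<le> 2 * (2 * C * B) * ((2 * C * r) ^ k / fact k)"
      by (intro Suc.IH generator_in_D abs_generator_h_le)
    then show "\<bar>deviation (generator h) r\<bar> \<le> 2 * B * (2 * C * ((2 * C * r) ^ k / fact k))"
      by (simp only: mult_ac)
  qed
  finally show ?case .
qed

theorem expectation_stationary:
  assumes "h \<in> D" and "0 \<le> s"
  shows "(\<integral>\<omega>. h (state_at s \<omega>) \<partial>M) = (\<integral>\<omega>. h (Y 0 \<omega>) \<partial>M)"
proof -
  obtain B where "\<And>x. x \<in> space S \<Longrightarrow> \<bar>h x\<bar> \<le> B"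
    using bounded_D[OF \<open>h \<in> D\<close>] by blast
  then have "\<bar>deviation h s\<bar> \<le> 2 * B * ((2 * C * s) ^ k / fact k)" for k
    by (intro abs_deviation_le_power_over_fact assms)
  then have "\<bar>deviation h s\<bar> \<le> 0"
    by (intro LIMSEQ_le_const[OF tendsto_mult_right_zero[OF power_over_fact_tendsto_0]]) blast
  then show ?thesis by (simp add: deviation_def)
qed

end

end

section \<open>Attachment and detachment\<close>

definition attached :: "nat \<Rightarrow> (nat \<Rightarrow> bool) \<Rightarrow> nat set" where
  "attached n \<psi> = {i. i < n \<and> \<psi> i}"

lemma finite_attached [simp]: "finite (attached n \<psi>)"
  by (simp add: attached_def)

lemma card_psi_eq_card_attached: "card_psi n \<psi> = card (attached n \<psi>)"
  by (simp add: card_psi_def attached_def)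

lemma card_psi_le: "card_psi n \<psi> \<le> n"
  using card_mono[of "{..<n}" "attached n \<psi>"] by (auto simp: card_psi_eq_card_attached attached_def)

lemma card_psi_pos: "i < n \<Longrightarrow> \<psi> i \<Longrightarrow> 0 < card_psi n \<psi>"
  by (auto simp: card_psi_eq_card_attached card_gt_0_iff attached_def)

lemma attached_s_i:
  "i < n \<Longrightarrow> attached n (s_i i \<psi>) = (if \<psi> i then attached n \<psi> - {i} else insert i (attached n \<psi>))"
  by (auto simp: attached_def s_i_def)

lemma card_psi_s_i:
  "i < n \<Longrightarrow> card_psi n (s_i i \<psi>) = (if \<psi> i then card_psi n \<psi> - 1 else Suc (card_psi n \<psi>))"
  unfolding card_psi_eq_card_attached attached_s_i by (simp add: card_Diff_singleton_if attached_def)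

lemma sum_if_attached:
  fixes g :: "nat \<Rightarrow> real"
  shows "(\<Sum>i<n. if \<psi> i then g i else b) = (\<Sum>i\<in>attached n \<psi>. g i) + (real n - real (card_psi n \<psi>)) * b"
proof -
  have attached_eq: "{..<n} \<inter> {i. \<psi> i} = attached n \<psi>" "{..<n} \<inter> - {i. \<psi> i} = {..<n} - attached n \<psi>"
    by (auto simp: attached_def)
  have "card ({..<n} - attached n \<psi>) = n - card_psi n \<psi>"
    by (subst card_Diff_subset) (auto simp: attached_def card_psi_def)
  then show ?thesis
    by (simp add: sum.If_cases attached_eq of_nat_diff[OF card_psi_le])
qed

lemma sum_centred_eq:
  fixes v :: "nat \<Rightarrow> 'a :: real_vector"
  shows "(\<Sum>i<n. of_bool (\<psi> i) *\<^sub>R (v i - v n)) = (\<Sum>i\<in>attached n \<psi>. v i) - real (card_psi n \<psi>) *\<^sub>R v n"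
proof -
  have "(\<Sum>i<n. of_bool (\<psi> i) *\<^sub>R (v i - v n)) = (\<Sum>i\<in>attached n \<psi>. v i - v n)"
    by (rule sum.mono_neutral_cong_right) (auto simp: attached_def)
  then show ?thesis
    by (simp add: sum_subtractf sum_constant_scaleR card_psi_eq_card_attached)
qed

lemma Xset_iff:
  "x \<in> Xset n \<longleftrightarrow> fst x \<in> extensional {..<n} \<and> snd x \<in> extensional {..<Suc n}
    \<and> (\<Sum>i\<in>attached n (fst x). snd x i) = real (card_psi n (fst x)) *\<^sub>R snd x n"
  by (cases x) (simp add: Xset_def sum_centred_eq)

text \<open>The detachment of the last attached object needs no separate clause, because \<open>1 / 0 = 0\<close>.\<close>

definition toggle :: "nat \<Rightarrow> nat \<Rightarrow> 'N::finite state \<Rightarrow> real^'N \<Rightarrow> 'N state" where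
  "toggle n i x y = (s_i i (fst x),
     if fst x i
     then (snd x)(n := snd x n - (1 / (real (card_psi n (fst x)) - 1)) *\<^sub>R (snd x i - snd x n))
     else (snd x)(i := y + snd x n, n := (1 / (real (card_psi n (fst x)) + 1)) *\<^sub>R y + snd x n))"

lemma centroid_toggle_detach:
  assumes x: "x \<in> Xset n" and i: "i < n" and att: "fst x i"
  shows "(\<Sum>j\<in>attached n (fst (toggle n i x y)). snd (toggle n i x y) j)
    = real (card_psi n (fst (toggle n i x y))) *\<^sub>R snd (toggle n i x y) n"
proof -
  obtain \<psi> v where x_eq: "x = (\<psi>, v)" by (cases x)
  let ?A = "attached n \<psi>" and ?k = "card_psi n \<psi>"
  have i_attached: "i \<in> ?A" and n_not_attached: "n \<notin> ?A" using i att by (simp_all add: attached_def x_eq)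
  have k: "0 < ?k" using card_psi_pos[OF i] att by (simp add: x_eq)
  have "(\<Sum>j\<in>attached n (s_i i \<psi>). snd (toggle n i x y) j) = (\<Sum>j\<in>?A - {i}. v j)"
    using att i n_not_attached by (intro sum.cong) (auto simp: attached_s_i toggle_def x_eq)
  also have "\<dots> = real ?k *\<^sub>R v n - v i"
    using x i_attached by (subst sum_diff1) (auto simp: Xset_iff x_eq)
  also have "\<dots> = (real ?k - 1) *\<^sub>R (v n - (1 / (real ?k - 1)) *\<^sub>R (v i - v n))"
  proof (cases "?k = 1")
    case True
    then have "?A = {i}"
      using i_attached by (auto simp: card_psi_eq_card_attached card_1_singleton_iff)
    then show ?thesis using x True by (simp add: Xset_iff x_eq)
  next
    case False
    then show ?thesis using k by (simp add: algebra_simps)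
  qed
  finally show ?thesis
    using i att k by (simp add: toggle_def x_eq card_psi_s_i of_nat_diff)
qed

lemma centroid_toggle_attach:
  assumes x: "x \<in> Xset n" and i: "i < n" and det: "\<not> fst x i"
  shows "(\<Sum>j\<in>attached n (fst (toggle n i x y)). snd (toggle n i x y) j)
    = real (card_psi n (fst (toggle n i x y))) *\<^sub>R snd (toggle n i x y) n"
proof -
  obtain \<psi> v where x_eq: "x = (\<psi>, v)" by (cases x)
  let ?A = "attached n \<psi>" and ?k = "card_psi n \<psi>"
  have "i \<notin> ?A" using det by (simp add: attached_def x_eq)
  then have "(\<Sum>j\<in>attached n (s_i i \<psi>). snd (toggle n i x y) j)
      = snd (toggle n i x y) i + (\<Sum>j\<in>?A. snd (toggle n i x y) j)"
    using i det by (simp add: attached_s_i x_eq)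
  also have "(\<Sum>j\<in>?A. snd (toggle n i x y) j) = (\<Sum>j\<in>?A. v j)"
    using det by (intro sum.cong) (auto simp: toggle_def x_eq attached_def)
  also have "\<dots> = real ?k *\<^sub>R v n"
    using x by (simp add: Xset_iff x_eq)
  also have "snd (toggle n i x y) i + real ?k *\<^sub>R v n = (real ?k + 1) *\<^sub>R ((1 / (real ?k + 1)) *\<^sub>R y + v n)"
    using i det by (simp add: toggle_def x_eq scaleR_add_right scaleR_add_left)
  finally show ?thesis using i det by (simp add: toggle_def x_eq card_psi_s_i add.commute)
qed

lemma toggle_in_Xset:
  assumes "x \<in> Xset n" and "i < n"
  shows "toggle n i x y \<in> Xset n"
proof -
  have "fst (toggle n i x y) \<in> extensional {..<n}" "snd (toggle n i x y) \<in> extensional {..<Suc n}"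
    using assms by (auto simp: Xset_iff toggle_def s_i_def extensional_def)
  then show ?thesis
    using assms centroid_toggle_detach centroid_toggle_attach unfolding Xset_iff[of "toggle n i x y"] by blast
qed

lemma space_stateM: "space (stateM n) = Xset n"
  by (auto simp: stateM_def space_restrict_space space_pair_measure space_PiM Xset_def PiE_def)

lemma measurable_fst_stateM [measurable]: "fst \<in> stateM n \<rightarrow>\<^sub>M PiM {..<n} (\<lambda>_. count_space UNIV)"
  unfolding stateM_def by (rule measurable_restrict_space1) measurable

lemma measurable_snd_stateM [measurable]:
  "snd \<in> (stateM n :: 'N::finite state measure) \<rightarrow>\<^sub>M PiM {..<Suc n} (\<lambda>_. borel)"
  unfolding stateM_def by (rule measurable_restrict_space1) measurable

lemma measurable_status [measurable (raw)]:
  assumes "j < n" and "f \<in> L \<rightarrow>\<^sub>M (stateM n :: 'N::finite state measure)"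
  shows "(\<lambda>z. fst (f z) j) \<in> L \<rightarrow>\<^sub>M count_space UNIV"
  using assms by (intro measurable_compose[OF measurable_compose[OF assms(2) measurable_fst_stateM]]
      measurable_component_singleton) auto

lemma measurable_location [measurable (raw)]:
  assumes "j \<le> n" and "f \<in> L \<rightarrow>\<^sub>M (stateM n :: 'N::finite state measure)"
  shows "(\<lambda>z. snd (f z) j) \<in> borel_measurable L"
  using assms by (intro measurable_compose[OF measurable_compose[OF assms(2) measurable_snd_stateM]]
      measurable_component_singleton) auto

lemma measurable_location_component [measurable]:
  fixes b :: "'N::finite"
  assumes [measurable]: "j \<le> n"
  shows "(\<lambda>x. snd x j $ b) \<in> borel_measurable (stateM n)"
  by (rule measurable_compose[OF _ borel_measurable_continuous_onI[of "\<lambda>u. u $ b"]])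
     (auto intro!: continuous_intros)

lemma measurable_card_psi [measurable (raw)]:
  assumes [measurable]: "f \<in> L \<rightarrow>\<^sub>M (stateM n :: 'N::finite state measure)"
  shows "(\<lambda>z. card_psi n (fst (f z))) \<in> L \<rightarrow>\<^sub>M count_space UNIV"
  unfolding card_psi_def
proof (rule measurable_card)
  fix i
  show "{z \<in> space L. i \<in> {i. i < n \<and> fst (f z) i}} \<in> sets L"
    by (cases "i < n") simp_all
qed

lemma measurable_stateM_I:
  fixes f :: "'a \<Rightarrow> 'N::finite state"
  assumes in_Xset: "\<And>z. z \<in> space L \<Longrightarrow> f z \<in> Xset n"
    and status: "\<And>j. j < n \<Longrightarrow> (\<lambda>z. fst (f z) j) \<in> L \<rightarrow>\<^sub>M count_space UNIV"
    and location: "\<And>j. j \<le> n \<Longrightarrow> (\<lambda>z. snd (f z) j) \<in> borel_measurable L"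
  shows "f \<in> L \<rightarrow>\<^sub>M stateM n"
proof -
  have "(\<lambda>z. fst (f z)) \<in> L \<rightarrow>\<^sub>M PiM {..<n} (\<lambda>_. count_space UNIV)"
    by (rule measurable_PiM_single') (use in_Xset status in \<open>auto simp: Xset_iff PiE_def\<close>)
  moreover have "(\<lambda>z. snd (f z)) \<in> L \<rightarrow>\<^sub>M PiM {..<Suc n} (\<lambda>_. borel)"
    by (rule measurable_PiM_single') (use in_Xset location in \<open>auto simp: Xset_iff PiE_def\<close>)
  ultimately have "(\<lambda>z. (fst (f z), snd (f z))) \<in> L \<rightarrow>\<^sub>M stateM n"
    unfolding stateM_def by (intro measurable_restrict_space2 measurable_Pair) (auto intro: in_Xset)
  then show ?thesis by simp
qed

lemma measurable_toggle [measurable (raw)]: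
  assumes i: "i < n" and f [measurable]: "f \<in> L \<rightarrow>\<^sub>M (stateM n :: 'N::finite state measure)"
    and [measurable]: "g \<in> borel_measurable L"
  shows "(\<lambda>z. toggle n i (f z) (g z)) \<in> L \<rightarrow>\<^sub>M stateM n"
proof (rule measurable_stateM_I)
  show "toggle n i (f z) (g z) \<in> Xset n" if "z \<in> space L" for z
    using measurable_space[OF f that] i by (intro toggle_in_Xset) (simp_all add: space_stateM)
next
  fix j assume j: "j < n"
  show "(\<lambda>z. fst (toggle n i (f z) (g z)) j) \<in> L \<rightarrow>\<^sub>M count_space UNIV"
    using i j by (cases "j = i") (simp_all add: toggle_def s_i_def)
next
  fix j assume j: "j \<le> n"
  have "snd (toggle n i x y) j =
     (if fst x i then
        if j = n then snd x n - (1 / (real (card_psi n (fst x)) - 1)) *\<^sub>R (snd x i - snd x n) else snd x j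
      else if j = n then (1 / (real (card_psi n (fst x)) + 1)) *\<^sub>R y + snd x n
      else if j = i then y + snd x n else snd x j)" for x :: "'N state" and y
    by (simp add: toggle_def)
  then show "(\<lambda>z. snd (toggle n i (f z) (g z)) j) \<in> borel_measurable L"
    using i j by simp
qed

definition total_norm :: "nat \<Rightarrow> 'N::finite state \<Rightarrow> real" where
  "total_norm n x = (\<Sum>j\<le>n. norm (snd x j))"

lemma total_norm_nonneg: "0 \<le> total_norm n x"
  by (simp add: total_norm_def sum_nonneg)

lemma norm_le_total_norm: "j \<le> n \<Longrightarrow> norm (snd x j) \<le> total_norm n x"
  unfolding total_norm_def by (rule member_le_sum) auto

lemma measurable_total_norm [measurable]: "total_norm n \<in> borel_measurable (stateM n)"
  unfolding total_norm_def by measurable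

lemma norm_toggle_le:
  assumes i: "i < n"
  shows "norm (snd (toggle n i x y) n) + norm (snd (toggle n i x y) i)
    \<le> 3 * (norm (snd x n) + norm (snd x i)) + 2 * norm y"
proof (cases "fst x i")
  case True
  let ?a = "1 / (real (card_psi n (fst x)) - 1)"
  have "0 < card_psi n (fst x)" using card_psi_pos[OF i] True by simp
  then have "\<bar>?a\<bar> \<le> 1" by (cases "card_psi n (fst x) = 1") auto
  then have "norm (?a *\<^sub>R (snd x i - snd x n)) \<le> norm (snd x i - snd x n)"
    unfolding norm_scaleR by (intro mult_left_le_one_le) auto
  also have "\<dots> \<le> norm (snd x i) + norm (snd x n)"
    by (rule norm_triangle_ineq4)
  finally have "norm (snd x n - ?a *\<^sub>R (snd x i - snd x n)) \<le> norm (snd x n) + (norm (snd x i) + norm (snd x n))"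
    by (intro order_trans[OF norm_triangle_ineq4]) simp
  moreover have "snd (toggle n i x y) n = snd x n - ?a *\<^sub>R (snd x i - snd x n)" "snd (toggle n i x y) i = snd x i"
    using True i by (auto simp: toggle_def)
  ultimately show ?thesis
    by (smt (verit) norm_ge_zero)
next
  case False
  let ?a = "1 / (real (card_psi n (fst x)) + 1)"
  have "norm (?a *\<^sub>R y) \<le> norm y"
    unfolding norm_scaleR by (intro mult_left_le_one_le) auto
  then have "norm (?a *\<^sub>R y + snd x n) \<le> norm y + norm (snd x n)"
    by (intro order_trans[OF norm_triangle_ineq]) simp
  moreover have "norm (y + snd x n) \<le> norm y + norm (snd x n)"
    by (rule norm_triangle_ineq)
  moreover have "snd (toggle n i x y) n = ?a *\<^sub>R y + snd x n" "snd (toggle n i x y) i = y + snd x n"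
    using False i by (auto simp: toggle_def)
  ultimately show ?thesis
    by (smt (verit) norm_ge_zero)
qed

lemma total_norm_toggle_le:
  assumes i: "i < n"
  shows "total_norm n (toggle n i x y) \<le> 3 * total_norm n x + 2 * norm y"
proof -
  have split: "total_norm n x = norm (snd x n) + norm (snd x i) + (\<Sum>j\<in>{..n} - {n, i}. norm (snd x j))"
    for x :: "'a state"
  proof -
    have "(\<Sum>j\<le>n. norm (snd x j)) = (\<Sum>j\<in>{n, i}. norm (snd x j)) + (\<Sum>j\<in>{..n} - {n, i}. norm (snd x j))"
      using i by (subst sum.subset_diff[of "{n, i}"]) auto
    then show ?thesis using i by (simp add: total_norm_def)
  qed
  have "(\<Sum>j\<in>{..n} - {n, i}. norm (snd (toggle n i x y) j)) = (\<Sum>j\<in>{..n} - {n, i}. norm (snd x j))"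
    by (intro sum.cong) (auto simp: toggle_def)
  moreover have "0 \<le> (\<Sum>j\<in>{..n} - {n, i}. norm (snd x j))"
    by (simp add: sum_nonneg)
  ultimately show ?thesis
    using norm_toggle_le[OF i, of x y] by (simp add: split)
qed

subsection \<open>The jump kernel and the generator\<close>

locale attachment_model = \<eta>: prob_space \<eta> for \<eta> :: "(real^'N::finite) measure" +
  fixes \<theta>a \<theta>d :: real and n :: nat
  assumes \<theta>a_pos: "0 < \<theta>a" and \<theta>d_pos: "0 < \<theta>d" and n_pos: "0 < n"
    and sets_\<eta> [measurable_cong]: "sets \<eta> = sets borel"
begin

abbreviation "S \<equiv> stateM n :: 'N state measure"

abbreviation "rate \<equiv> rate_fun \<theta>a \<theta>d n"

definition kernel :: "'N state \<Rightarrow> 'N state measure" where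
  "kernel x = distr (density (count_space {..<n} \<Otimes>\<^sub>M \<eta>) (\<lambda>p. ennreal (r_i \<theta>a \<theta>d n (fst p) (fst x)))) S
     (\<lambda>p. toggle n (fst p) x (snd p))"

lemma sets_kernel: "sets (kernel x) = sets S"
  by (simp add: kernel_def)

lemma rate_eq_sum: "rate x = (\<Sum>i<n. if fst x i then \<theta>d else \<theta>a)"
  unfolding sum_if_attached by (simp add: rate_fun_def card_psi_eq_card_attached mult.commute)

lemma rate_pos: "0 < rate x"
  unfolding rate_eq_sum using \<theta>a_pos \<theta>d_pos n_pos by (intro sum_pos) auto

lemma rate_le: "rate x \<le> (\<theta>a + \<theta>d) * real n"
proof -
  have "rate x \<le> (\<Sum>i<n. \<theta>a + \<theta>d)"
    unfolding rate_eq_sum using \<theta>a_pos \<theta>d_pos by (intro sum_mono) auto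
  then show ?thesis by (simp add: mult.commute)
qed

lemma measurable_rate: "rate \<in> borel_measurable S"
  unfolding rate_fun_def by measurable

lemma r_i_eq: "r_i \<theta>a \<theta>d n i (fst x) = (if fst x i then \<theta>d else \<theta>a) / rate x" for x :: "'N state"
  by (simp add: r_i_def rate_fun_def)

lemma r_i_nonneg: "0 \<le> r_i \<theta>a \<theta>d n i (fst x)" for x :: "'N state"
  using rate_pos[of x] \<theta>a_pos \<theta>d_pos by (simp add: r_i_eq)

lemma sum_r_i: "(\<Sum>i<n. r_i \<theta>a \<theta>d n i (fst x)) = 1" for x :: "'N state"
  using rate_pos[of x] by (simp add: r_i_eq flip: rate_eq_sum sum_divide_distrib)

lemma measurable_r_i [measurable]:
  assumes [measurable]: "i < n"
  shows "(\<lambda>x. r_i \<theta>a \<theta>d n i (fst x)) \<in> borel_measurable S"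
  unfolding r_i_eq using measurable_rate by measurable

lemma measurable_r_i_index [measurable]:
  "(\<lambda>p. r_i \<theta>a \<theta>d n (fst p) \<psi>) \<in> borel_measurable (count_space {..<n} \<Otimes>\<^sub>M \<eta>)"
  by (rule measurable_compose[OF measurable_fst]) simp

lemma measurable_toggle_noise:
  assumes "x \<in> Xset n"
  shows "(\<lambda>p. toggle n (fst p) x (snd p)) \<in> count_space {..<n} \<Otimes>\<^sub>M \<eta> \<rightarrow>\<^sub>M S"
proof (rule measurable_pair_measure_countable1)
  fix i assume "i \<in> {..<n}"
  then show "(\<lambda>y. toggle n (fst (i, y)) x (snd (i, y))) \<in> \<eta> \<rightarrow>\<^sub>M S"
    using assms by (simp add: space_stateM)
qed simp

lemma nn_integral_kernel:
  assumes x: "x \<in> Xset n" and [measurable]: "f \<in> borel_measurable S"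
  shows "(\<integral>\<^sup>+z. f z \<partial>kernel x) = (\<Sum>i<n. ennreal (r_i \<theta>a \<theta>d n i (fst x)) * (\<integral>\<^sup>+y. f (toggle n i x y) \<partial>\<eta>))"
proof -
  note [measurable] = measurable_toggle_noise[OF x]
  let ?g = "\<lambda>p. ennreal (r_i \<theta>a \<theta>d n (fst p) (fst x)) * f (toggle n (fst p) x (snd p))"
  have "(\<integral>\<^sup>+z. f z \<partial>kernel x) = (\<integral>\<^sup>+p. ?g p \<partial>(count_space {..<n} \<Otimes>\<^sub>M \<eta>))"
    unfolding kernel_def by (simp add: nn_integral_distr nn_integral_density)
  also have "\<dots> = (\<integral>\<^sup>+i. \<integral>\<^sup>+y. ?g (i, y) \<partial>\<eta> \<partial>count_space {..<n})"
    by (rule \<eta>.nn_integral_fst[symmetric]) measurable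
  also have "\<dots> = (\<integral>\<^sup>+i. ennreal (r_i \<theta>a \<theta>d n i (fst x)) * (\<integral>\<^sup>+y. f (toggle n i x y) \<partial>\<eta>) \<partial>count_space {..<n})"
    unfolding fst_conv snd_conv
  proof (intro nn_integral_cong nn_integral_cmult)
    fix i assume "i \<in> space (count_space {..<n})"
    then show "(\<lambda>y. f (toggle n i x y)) \<in> borel_measurable \<eta>"
      using x by (simp add: space_stateM)
  qed
  finally show ?thesis
    by (simp add: nn_integral_count_space_finite)
qed

lemma integral_kernel:
  fixes f :: "'N state \<Rightarrow> real"
  assumes x: "x \<in> Xset n" and [measurable]: "f \<in> borel_measurable S"
    and integrable_f: "\<And>i. i < n \<Longrightarrow> integrable \<eta> (\<lambda>y. f (toggle n i x y))"
  shows "(\<integral>z. f z \<partial>kernel x) = (\<Sum>i<n. r_i \<theta>a \<theta>d n i (fst x) * (\<integral>y. f (toggle n i x y) \<partial>\<eta>))"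
proof -
  note [measurable] = measurable_toggle_noise[OF x]
  interpret C: sigma_finite_measure "count_space {..<n}"
    by (rule sigma_finite_measure_count_space_finite) simp
  interpret P: pair_sigma_finite "count_space {..<n}" \<eta> ..
  let ?g = "\<lambda>p. r_i \<theta>a \<theta>d n (fst p) (fst x) * f (toggle n (fst p) x (snd p))"
  have "integrable (count_space {..<n} \<Otimes>\<^sub>M \<eta>) ?g"
  proof (rule P.Fubini_integrable)
    show "integrable (count_space {..<n}) (\<lambda>i. \<integral>y. norm (?g (i, y)) \<partial>\<eta>)"
      by (rule integrable_count_space) simp
    show "AE i in count_space {..<n}. integrable \<eta> (\<lambda>y. ?g (i, y))"
      using integrable_f by (simp add: AE_count_space)
  qed measurable
  then have iterated: "(\<integral>p. ?g p \<partial>(count_space {..<n} \<Otimes>\<^sub>M \<eta>)) = (\<integral>i. \<integral>y. ?g (i, y) \<partial>\<eta> \<partial>count_space {..<n})"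
    by (rule P.integral_fst'[symmetric])
  have "(\<integral>z. f z \<partial>kernel x) = (\<integral>p. ?g p \<partial>(count_space {..<n} \<Otimes>\<^sub>M \<eta>))"
    unfolding kernel_def by (simp add: integral_distr integral_density r_i_nonneg)
  also have "\<dots> = (\<Sum>i<n. r_i \<theta>a \<theta>d n i (fst x) * (\<integral>y. f (toggle n i x y) \<partial>\<eta>))"
    unfolding iterated by (simp add: lebesgue_integral_count_space_finite)
  finally show ?thesis .
qed

lemma emeasure_kernel:
  assumes x: "x \<in> Xset n" and [measurable]: "B \<in> sets S"
  shows "emeasure (kernel x) B = (\<Sum>i<n. ennreal (r_i \<theta>a \<theta>d n i (fst x)) * (\<integral>\<^sup>+y. indicator B (toggle n i x y) \<partial>\<eta>))"
proof -
  have "emeasure (kernel x) B = (\<integral>\<^sup>+z. indicator B z \<partial>kernel x)"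
    by (simp add: sets_kernel)
  then show ?thesis
    by (simp add: nn_integral_kernel[OF x])
qed

lemma prob_space_kernel:
  assumes "x \<in> Xset n"
  shows "prob_space (kernel x)"
proof
  have "space (kernel x) = space S" by (simp add: kernel_def)
  moreover have "(\<integral>\<^sup>+y. indicator (space S) (toggle n i x y) \<partial>\<eta>) = (1 :: ennreal)" if "i < n" for i
  proof -
    have "(\<integral>\<^sup>+y. indicator (space S) (toggle n i x y) \<partial>\<eta>) = (\<integral>\<^sup>+y. 1 \<partial>\<eta>)"
      using that assms by (intro nn_integral_cong) (simp add: space_stateM toggle_in_Xset)
    then show ?thesis by (simp add: \<eta>.emeasure_space_1)
  qed
  ultimately show "emeasure (kernel x) (space (kernel x)) = 1"
    using assms by (simp add: emeasure_kernel sum_ennreal r_i_nonneg sum_r_i)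
qed

lemma measurable_kernel: "kernel \<in> S \<rightarrow>\<^sub>M prob_algebra S"
proof (rule measurable_prob_algebraI)
  show "prob_space (kernel x)" if "x \<in> space S" for x
    using that by (simp add: prob_space_kernel space_stateM)
  show "kernel \<in> S \<rightarrow>\<^sub>M subprob_algebra S"
  proof (rule measurable_subprob_algebra)
    fix B assume [measurable]: "B \<in> sets S"
    have "(\<lambda>x. \<Sum>i<n. ennreal (r_i \<theta>a \<theta>d n i (fst x)) * (\<integral>\<^sup>+y. indicator B (toggle n i x y) \<partial>\<eta>)) \<in> borel_measurable S"
      by (intro borel_measurable_sum) simp
    then show "(\<lambda>x. emeasure (kernel x) B) \<in> borel_measurable S"
      by (rule measurable_cong[THEN iffD1, rotated]) (simp add: emeasure_kernel space_stateM)
  qed (simp_all add: space_stateM sets_kernel prob_space_imp_subprob_space prob_space_kernel)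
qed

lemma lam_i_eq_nn_integral:
  assumes x: "x \<in> Xset n" and i: "i < n" and [measurable]: "B \<in> sets S"
  shows "ennreal (lam_i \<eta> n i x B) = (\<integral>\<^sup>+y. indicator B (toggle n i x y) \<partial>\<eta>)"
proof (cases "fst x i")
  case True
  then have "toggle n i x y = toggle n i x 0" for y
    by (simp add: toggle_def)
  then have "(\<integral>\<^sup>+y. indicator B (toggle n i x y) \<partial>\<eta>) = (\<integral>\<^sup>+y. indicator B (toggle n i x 0) \<partial>\<eta>)"
    by metis
  moreover have "lam_i \<eta> n i x B = indicator B (toggle n i x 0)"
    using True by (cases "card_psi n (fst x) = 1") (simp_all add: lam_i_def Let_def toggle_def)
  ultimately show ?thesis
    by (simp add: \<eta>.emeasure_space_1 ennreal_indicator)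
next
  case False
  have [measurable]: "(\<lambda>y. toggle n i x y) \<in> \<eta> \<rightarrow>\<^sub>M S"
    using x i by (simp add: space_stateM)
  have "lam_i \<eta> n i x B = measure \<eta> {y \<in> space \<eta>. toggle n i x y \<in> B}"
    using False by (simp add: lam_i_def Let_def toggle_def)
  also have "ennreal \<dots> = (\<integral>\<^sup>+y. indicator {y \<in> space \<eta>. toggle n i x y \<in> B} y \<partial>\<eta>)"
    by (simp add: \<eta>.emeasure_eq_measure)
  also have "\<dots> = (\<integral>\<^sup>+y. indicator B (toggle n i x y) \<partial>\<eta>)"
    by (intro nn_integral_cong) (simp add: indicator_def)
  finally show ?thesis .
qed

lemma measure_kernel_eq_jump_kernel:
  assumes x: "x \<in> Xset n" and sets_B: "B \<in> sets S"
  shows "measure (kernel x) B = jump_kernel \<theta>a \<theta>d \<eta> n x B"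
proof -
  have lam_nonneg: "0 \<le> lam_i \<eta> n i x B" for i
    by (simp add: lam_i_def Let_def)
  have "emeasure (kernel x) B = (\<Sum>i<n. ennreal (r_i \<theta>a \<theta>d n i (fst x)) * ennreal (lam_i \<eta> n i x B))"
    by (simp add: emeasure_kernel[OF x sets_B] lam_i_eq_nn_integral[OF x _ sets_B])
  also have "\<dots> = ennreal (jump_kernel \<theta>a \<theta>d \<eta> n x B)"
    by (simp add: jump_kernel_def sum_ennreal r_i_nonneg lam_nonneg flip: ennreal_mult)
  moreover have "0 \<le> jump_kernel \<theta>a \<theta>d \<eta> n x B"
    unfolding jump_kernel_def by (intro sum_nonneg mult_nonneg_nonneg r_i_nonneg lam_nonneg)
  ultimately show ?thesis by (simp add: measure_def)
qed

abbreviation "generator \<equiv> jump_generator rate kernel"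

lemma generator_eq_sum:
  fixes f :: "'N state \<Rightarrow> real"
  assumes "x \<in> Xset n" and "f \<in> borel_measurable S"
    and integrable_f: "\<And>i. i < n \<Longrightarrow> integrable \<eta> (\<lambda>y. f (toggle n i x y))"
  shows "generator f x = (\<Sum>i<n. (if fst x i then \<theta>d else \<theta>a) * ((\<integral>y. f (toggle n i x y) \<partial>\<eta>) - f x))"
proof -
  have "(\<integral>z. f z \<partial>kernel x) - f x = (\<Sum>i<n. r_i \<theta>a \<theta>d n i (fst x) * ((\<integral>y. f (toggle n i x y) \<partial>\<eta>) - f x))"
    by (simp add: integral_kernel[OF assms] right_diff_distrib sum_subtractf sum_r_i flip: sum_distrib_right)
  then show ?thesis
    using rate_pos[of x] by (simp add: jump_generator_def sum_distrib_left r_i_eq)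
qed

definition card_generator :: "(nat \<Rightarrow> real) \<Rightarrow> nat \<Rightarrow> real" where
  "card_generator h k = \<theta>d * real k * (h (k - 1) - h k) + \<theta>a * (real n - real k) * (h (Suc k) - h k)"

lemma generator_card_psi:
  assumes x: "x \<in> Xset n"
  shows "generator (\<lambda>z. h (card_psi n (fst z))) x = card_generator h (card_psi n (fst x))"
proof -
  let ?k = "card_psi n (fst x)"
  have card_toggle: "card_psi n (fst (toggle n i x y)) = (if fst x i then ?k - 1 else Suc ?k)" if "i < n" for i y
    using that by (simp add: toggle_def card_psi_s_i)
  have "generator (\<lambda>z. h (card_psi n (fst z))) x
      = (\<Sum>i<n. (if fst x i then \<theta>d else \<theta>a) * ((\<integral>y. h (card_psi n (fst (toggle n i x y))) \<partial>\<eta>) - h ?k))"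
    using x by (intro generator_eq_sum) (simp_all add: card_toggle)
  also have "\<dots> = (\<Sum>i<n. if fst x i then \<theta>d * (h (?k - 1) - h ?k) else \<theta>a * (h (Suc ?k) - h ?k))"
    by (intro sum.cong refl) (simp add: card_toggle \<eta>.prob_space)
  finally show ?thesis
    by (simp add: sum_if_attached card_generator_def mult_ac flip: card_psi_eq_card_attached)
qed

definition centroid_drift :: "nat \<Rightarrow> real" where
  "centroid_drift k = \<theta>a * (real n - real k) / (real k + 1)"

text \<open>The shifts of the centroid caused by detachments cancel, because the attached objects are centred at it.\<close>

lemma generator_centroid:
  assumes x: "x \<in> Xset n" and integrable_noise: "integrable \<eta> (\<lambda>y. y $ b)"
  shows "generator (\<lambda>z. snd z n $ b) x = centroid_drift (card_psi n (fst x)) * (\<integral>y. y $ b \<partial>\<eta>)"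
proof -
  let ?k = "card_psi n (fst x)" and ?v = "snd x" and ?e = "\<integral>y. y $ b \<partial>\<eta>"
  let ?a = "1 / (real ?k - 1)"
  have centroid_toggle: "snd (toggle n i x y) n $ b = ?v n $ b
      + (if fst x i then - ?a * (?v i $ b - ?v n $ b) else y $ b / (real ?k + 1))" for i y
    by (simp add: toggle_def)
  have "generator (\<lambda>z. snd z n $ b) x
      = (\<Sum>i<n. (if fst x i then \<theta>d else \<theta>a) * ((\<integral>y. snd (toggle n i x y) n $ b \<partial>\<eta>) - ?v n $ b))"
  proof (rule generator_eq_sum[OF x])
    show "integrable \<eta> (\<lambda>y. snd (toggle n i x y) n $ b)" for i
      using integrable_noise by (cases "fst x i") (simp_all add: centroid_toggle)
  qed measurable
  also have "\<dots> = (\<Sum>i<n. if fst x i then - (\<theta>d * ?a) * (?v i $ b - ?v n $ b) else \<theta>a * (?e / (real ?k + 1)))"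
    using integrable_noise by (intro sum.cong refl) (simp add: centroid_toggle \<eta>.prob_space)
  also have "\<dots> = - (\<theta>d * ?a) * ((\<Sum>i\<in>attached n (fst x). ?v i $ b) - real ?k * (?v n $ b))
      + (real n - real ?k) * (\<theta>a * (?e / (real ?k + 1)))"
    unfolding sum_if_attached
    by (simp only: sum_distrib_left[symmetric] sum_subtractf sum_constant card_psi_eq_card_attached)
  also have "(\<Sum>i\<in>attached n (fst x). ?v i $ b) = real ?k * (?v n $ b)"
    using x by (simp add: Xset_iff flip: sum_component)
  finally show ?thesis
    by (simp add: centroid_drift_def)
qed

end

subsection \<open>The binomial law of the number of attached objects\<close>

lemma sigma_w_nonneg: "0 < \<theta>a \<Longrightarrow> 0 < \<theta>d \<Longrightarrow> 0 \<le> sigma_w \<theta>a \<theta>d n k"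
  by (simp add: sigma_w_def)

lemma sigma_w_balance:
  assumes "k < n"
  shows "sigma_w \<theta>a \<theta>d n (Suc k) * (\<theta>d * real (Suc k)) = sigma_w \<theta>a \<theta>d n k * (\<theta>a * (real n - real k))"
proof -
  have "Suc k * (n choose Suc k) = (n - k) * (n choose k)"
    using binomial_absorption[of k n] binomial_absorb_comp[of n k] by simp
  then have absorb: "real (Suc k) * real (n choose Suc k) = (real n - real k) * real (n choose k)"
    using assms by (metis of_nat_diff of_nat_mult less_imp_le)
  have power: "\<theta>d ^ (n - k) = \<theta>d * \<theta>d ^ (n - Suc k)"
    using assms by (simp add: Suc_diff_Suc flip: power_Suc)
  have "real (n choose Suc k) * \<theta>d ^ (n - Suc k) * \<theta>a ^ Suc k * (\<theta>d * real (Suc k))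
     = (real (Suc k) * real (n choose Suc k)) * (\<theta>d * \<theta>d ^ (n - Suc k)) * \<theta>a ^ k * \<theta>a"
    by (simp add: mult_ac del: of_nat_Suc)
  also have "\<dots> = real (n choose k) * \<theta>d ^ (n - k) * \<theta>a ^ k * (\<theta>a * (real n - real k))"
    unfolding absorb power by (simp add: mult_ac)
  finally show ?thesis
    using assms by (simp add: sigma_w_def del: of_nat_Suc power_Suc)
qed

lemma sum_sigma_w:
  assumes "0 < \<theta>a" "0 < \<theta>d"
  shows "(\<Sum>k\<le>n. sigma_w \<theta>a \<theta>d n k) = 1"
proof -
  have "(\<Sum>k\<le>n. sigma_w \<theta>a \<theta>d n k) = (\<Sum>k\<le>n. real (n choose k) * \<theta>a ^ k * \<theta>d ^ (n - k)) / (\<theta>d + \<theta>a) ^ n"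
    unfolding sum_divide_distrib by (intro sum.cong) (auto simp: sigma_w_def mult_ac)
  also have "\<dots> = 1"
    unfolding binomial_ring[symmetric] using assms by (simp add: add.commute)
  finally show ?thesis .
qed

context attachment_model
begin

lemma sum_sigma_w_card_generator: "(\<Sum>k\<le>n. sigma_w \<theta>a \<theta>d n k * card_generator h k) = 0"
proof -
  let ?\<sigma> = "sigma_w \<theta>a \<theta>d n" and ?\<Delta> = "\<lambda>k. h (Suc k) - h k"
  obtain m where n: "n = Suc m"
    using n_pos by (cases n) auto
  have down: "(\<Sum>k\<le>n. ?\<sigma> k * (\<theta>d * real k) * (h (k - 1) - h k)) = (\<Sum>k\<le>m. ?\<sigma> (Suc k) * (\<theta>d * real (Suc k)) * - ?\<Delta> k)"
    unfolding n by (subst sum.atMost_Suc_shift) simp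
  have up: "(\<Sum>k\<le>n. ?\<sigma> k * (\<theta>a * (real n - real k)) * ?\<Delta> k) = (\<Sum>k\<le>m. ?\<sigma> (Suc k) * (\<theta>d * real (Suc k)) * ?\<Delta> k)"
    unfolding n by (simp del: of_nat_Suc add: sigma_w_balance)
  have "(\<Sum>k\<le>n. ?\<sigma> k * card_generator h k)
      = (\<Sum>k\<le>n. ?\<sigma> k * (\<theta>d * real k) * (h (k - 1) - h k)) + (\<Sum>k\<le>n. ?\<sigma> k * (\<theta>a * (real n - real k)) * ?\<Delta> k)"
    by (simp add: card_generator_def distrib_left mult.assoc flip: sum.distrib)
  also have "\<dots> = 0"
    unfolding down up by (simp only: mult_minus_right sum_negf left_minus)
  finally show ?thesis .
qed

lemma sum_sigma_w_centroid_drift: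
  "(\<Sum>k\<le>n. sigma_w \<theta>a \<theta>d n k * centroid_drift k) = \<theta>d / (\<theta>d + \<theta>a) ^ n * ((\<theta>d + \<theta>a) ^ n - \<theta>d ^ n)"
proof -
  let ?\<sigma> = "sigma_w \<theta>a \<theta>d n"
  have "(\<Sum>k\<le>n. ?\<sigma> k * centroid_drift k) = (\<Sum>k<n. ?\<sigma> k * centroid_drift k)"
    by (simp add: centroid_drift_def flip: lessThan_Suc_atMost)
  also have "\<dots> = (\<Sum>k<n. \<theta>d * ?\<sigma> (Suc k))"
  proof (intro sum.cong refl)
    fix k assume "k \<in> {..<n}"
    then show "?\<sigma> k * centroid_drift k = \<theta>d * ?\<sigma> (Suc k)"
      using sigma_w_balance[of k n \<theta>a \<theta>d] by (simp add: centroid_drift_def field_simps)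
  qed
  also have "\<dots> = \<theta>d * ((\<Sum>k<Suc n. ?\<sigma> k) - ?\<sigma> 0)"
    by (simp only: sum.lessThan_Suc_shift sum_distrib_left[symmetric]) simp
  also have "\<dots> = \<theta>d * (1 - \<theta>d ^ n / (\<theta>d + \<theta>a) ^ n)"
    unfolding lessThan_Suc_atMost sum_sigma_w[OF \<theta>a_pos \<theta>d_pos] by (simp add: sigma_w_def)
  also have "\<dots> = \<theta>d / (\<theta>d + \<theta>a) ^ n * ((\<theta>d + \<theta>a) ^ n - \<theta>d ^ n)"
    using \<theta>a_pos \<theta>d_pos by (simp add: field_simps)
  finally show ?thesis .
qed

end

subsection \<open>The process\<close>

locale attachment_process = attachment_model \<eta> \<theta>a \<theta>d n + exponential_clocks M \<gamma>
  for \<eta> :: "(real^'N::finite) measure" and \<theta>a \<theta>d :: real and n :: nat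
    and M :: "'w measure" and \<gamma> :: "nat \<Rightarrow> 'w \<Rightarrow> real" +
  fixes R :: real and \<rho> :: "'N state measure" and Y :: "nat \<Rightarrow> 'w \<Rightarrow> 'N state"
  assumes R_pos: "0 < R" and bounded_\<eta>: "AE y in \<eta>. \<forall>i. \<bar>y $ i\<bar> \<le> R"
    and sets_\<rho>: "sets \<rho> = sets (stateM n)"
    and card_\<rho>: "distr \<rho> (count_space UNIV) (\<lambda>x. card_psi n (fst x))
      = density (count_space UNIV) (\<lambda>k. ennreal (sigma_w \<theta>a \<theta>d n k))"
    and integrable_\<rho>: "\<forall>i\<le>n. integrable \<rho> (\<lambda>x. snd x i)"
    and measurable_Y: "\<forall>k. Y k \<in> M \<rightarrow>\<^sub>M stateM n"
    and distr_Y_0: "distr M (stateM n) (Y 0) = \<rho>"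
    and markov_Y: "\<forall>k B. (\<forall>j. B j \<in> sets (stateM n)) \<longrightarrow>
      measure M {\<omega> \<in> space M. \<forall>j\<le>Suc k. Y j \<omega> \<in> B j}
        = (\<integral>\<omega>. indicator {\<omega> \<in> space M. \<forall>j\<le>k. Y j \<omega> \<in> B j} \<omega>
            * jump_kernel \<theta>a \<theta>d \<eta> n (Y k \<omega>) (B (Suc k)) \<partial>M)"
    and indep_Y_\<gamma>: "indep_set
      {(\<lambda>\<omega> k. Y k \<omega>) -` A \<inter> space M | A. A \<in> sets (PiM UNIV (\<lambda>_. stateM n))}
      {(\<lambda>\<omega>. restrict (\<lambda>k. \<gamma> k \<omega>) {1..}) -` A \<inter> space M | A. A \<in> sets (PiM {1..} (\<lambda>_. borel))}"
begin

lemma random_variable_Y [measurable]: "Y k \<in> M \<rightarrow>\<^sub>M S"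
  using measurable_Y by simp

lemma Y_in_Xset: "\<omega> \<in> space M \<Longrightarrow> Y k \<omega> \<in> Xset n"
  using measurable_space[OF random_variable_Y] by (simp add: space_stateM)

sublocale jump: jump_process M \<gamma> S kernel rate "(\<theta>a + \<theta>d) * real n" Y
proof
  fix k and B :: "nat \<Rightarrow> 'N state set" assume sets_B: "\<And>j. B j \<in> sets S"
  then have "prob {\<omega> \<in> space M. \<forall>j\<le>Suc k. Y j \<omega> \<in> B j}
      = (\<integral>\<omega>. indicator {\<omega> \<in> space M. \<forall>j\<le>k. Y j \<omega> \<in> B j} \<omega> * jump_kernel \<theta>a \<theta>d \<eta> n (Y k \<omega>) (B (Suc k)) \<partial>M)"
    by (intro markov_Y[rule_format])
  also have "\<dots> = (\<integral>\<omega>. indicator {\<omega> \<in> space M. \<forall>j\<le>k. Y j \<omega> \<in> B j} \<omega> * measure (kernel (Y k \<omega>)) (B (Suc k)) \<partial>M)"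
    by (intro Bochner_Integration.integral_cong refl) (simp add: measure_kernel_eq_jump_kernel Y_in_Xset sets_B)
  finally show "prob {\<omega> \<in> space M. \<forall>j\<le>Suc k. Y j \<omega> \<in> B j}
      = (\<integral>\<omega>. indicator {\<omega> \<in> space M. \<forall>j\<le>k. Y j \<omega> \<in> B j} \<omega> * measure (kernel (Y k \<omega>)) (B (Suc k)) \<partial>M)" .
qed (rule measurable_kernel measurable_rate rate_pos rate_le random_variable_Y indep_Y_\<gamma>)+

lemma Xproc_eq_state_at: "Xproc rate Y \<gamma> s \<omega> = jump.state_at s \<omega>"
proof -
  have "jump_time rate Y \<gamma> k \<omega> = jump.arrival_time k \<omega>" for k
    unfolding jump_time_def jump.arrival_time_def ring_time_def by (simp add: sum.atLeast1_atMost_eq)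
  then show ?thesis
    by (simp add: Xproc_def jump.state_at_def)
qed

lemma expectation_card_initial:
  fixes h :: "nat \<Rightarrow> real"
  shows "expectation (\<lambda>\<omega>. h (card_psi n (fst (Y 0 \<omega>)))) = (\<Sum>k\<le>n. sigma_w \<theta>a \<theta>d n k * h k)"
proof -
  note [measurable_cong] = sets_\<rho>
  have "expectation (\<lambda>\<omega>. h (card_psi n (fst (Y 0 \<omega>)))) = (\<integral>x. h (card_psi n (fst x)) \<partial>\<rho>)"
    unfolding distr_Y_0[symmetric] by (subst integral_distr) auto
  also have "\<dots> = (\<integral>k. h k \<partial>density (count_space UNIV) (\<lambda>k. ennreal (sigma_w \<theta>a \<theta>d n k)))"
    unfolding card_\<rho>[symmetric] by (subst integral_distr) measurable
  also have "\<dots> = (\<integral>k. sigma_w \<theta>a \<theta>d n k * h k \<partial>count_space UNIV)"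
    by (subst integral_density) (auto simp: sigma_w_nonneg \<theta>a_pos \<theta>d_pos)
  also have "\<dots> = (\<Sum>k | sigma_w \<theta>a \<theta>d n k * h k \<noteq> 0. sigma_w \<theta>a \<theta>d n k * h k)"
    by (subst lebesgue_integral_count_space_finite_support)
       (auto intro!: finite_subset[of _ "{..n}"] simp: sigma_w_def split: if_splits)
  also have "\<dots> = (\<Sum>k\<le>n. sigma_w \<theta>a \<theta>d n k * h k)"
    by (rule sum.mono_neutral_left) (auto simp: sigma_w_def split: if_splits)
  finally show ?thesis .
qed

lemma bounded_fun_card_psi: "\<exists>B. \<forall>\<psi>. \<bar>h (card_psi n \<psi>) :: real\<bar> \<le> B"
proof (intro exI allI)
  show "\<bar>h (card_psi n \<psi>)\<bar> \<le> (\<Sum>k\<le>n. \<bar>h k\<bar>)" for \<psi>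
    by (rule member_le_sum) (auto simp: card_psi_le)
qed

definition card_functions :: "('N state \<Rightarrow> real) set" where
  "card_functions = {f \<in> borel_measurable S. \<exists>h. \<forall>x\<in>Xset n. f x = h (card_psi n (fst x))}"

lemma card_functionsE:
  assumes "f \<in> card_functions"
  obtains h where "\<And>x. x \<in> Xset n \<Longrightarrow> f x = h (card_psi n (fst x))"
  using assms by (auto simp: card_functions_def)

lemma generator_card_functionsE:
  assumes "f \<in> card_functions"
  obtains h where "\<And>x. x \<in> Xset n \<Longrightarrow> generator f x = card_generator h (card_psi n (fst x))"
proof -
  obtain h where h: "\<And>x. x \<in> Xset n \<Longrightarrow> f x = h (card_psi n (fst x))"
    using card_functionsE[OF assms] by blast
  have "(\<integral>z. f z \<partial>kernel x) = (\<integral>z. h (card_psi n (fst z)) \<partial>kernel x)" for x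
    by (intro Bochner_Integration.integral_cong refl h)
       (simp add: sets_eq_imp_space_eq[OF sets_kernel] space_stateM)
  then have "generator f x = generator (\<lambda>z. h (card_psi n (fst z))) x" if "x \<in> Xset n" for x
    using h[OF that] by (simp add: jump_generator_def)
  then show ?thesis
    using that generator_card_psi by simp
qed

lemma bounded_card_functions:
  assumes "f \<in> card_functions"
  shows "\<exists>B. \<forall>x\<in>space S. \<bar>f x\<bar> \<le> B"
proof -
  obtain h where "\<And>x. x \<in> Xset n \<Longrightarrow> f x = h (card_psi n (fst x))"
    using card_functionsE[OF assms] by blast
  with bounded_fun_card_psi[of h] show ?thesis
    by (auto simp: space_stateM)
qed

lemma generator_card_functions:
  assumes "f \<in> card_functions"
  shows "generator f \<in> card_functions"
proof -
  have "generator f \<in> borel_measurable S"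
    using assms by (intro jump.measurable_generator) (simp add: card_functions_def)
  moreover obtain h where "\<And>x. x \<in> Xset n \<Longrightarrow> generator f x = card_generator h (card_psi n (fst x))"
    using generator_card_functionsE[OF assms] by blast
  ultimately show ?thesis
    by (auto simp: card_functions_def)
qed

lemma expectation_generator_card_functions:
  assumes "f \<in> card_functions"
  shows "expectation (\<lambda>\<omega>. generator f (Y 0 \<omega>)) = 0"
proof -
  obtain h where "\<And>x. x \<in> Xset n \<Longrightarrow> generator f x = card_generator h (card_psi n (fst x))"
    using generator_card_functionsE[OF assms] by blast
  then have "expectation (\<lambda>\<omega>. generator f (Y 0 \<omega>)) = expectation (\<lambda>\<omega>. card_generator h (card_psi n (fst (Y 0 \<omega>))))"
    by (intro Bochner_Integration.integral_cong refl) (simp add: Y_in_Xset)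
  then show ?thesis
    by (simp add: expectation_card_initial sum_sigma_w_card_generator)
qed

lemma expectation_card_stationary:
  fixes h :: "nat \<Rightarrow> real"
  assumes "0 \<le> s"
  shows "expectation (\<lambda>\<omega>. h (card_psi n (fst (jump.state_at s \<omega>)))) = (\<Sum>k\<le>n. sigma_w \<theta>a \<theta>d n k * h k)"
proof -
  have "expectation (\<lambda>\<omega>. h (card_psi n (fst (jump.state_at s \<omega>)))) = expectation (\<lambda>\<omega>. h (card_psi n (fst (Y 0 \<omega>))))"
  proof (rule jump.expectation_stationary[where D=card_functions and h="\<lambda>x. h (card_psi n (fst x))"])
    show "(\<lambda>x. h (card_psi n (fst x))) \<in> card_functions"
      by (auto simp: card_functions_def)
    fix f assume f: "f \<in> card_functions"
    then show "f \<in> borel_measurable S"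
      by (simp add: card_functions_def)
    show "\<exists>B. \<forall>x\<in>space S. \<bar>f x\<bar> \<le> B"
      by (rule bounded_card_functions[OF f])
    show "generator f \<in> card_functions"
      by (rule generator_card_functions[OF f])
    show "expectation (\<lambda>\<omega>. generator f (Y 0 \<omega>)) = 0"
      by (rule expectation_generator_card_functions[OF f])
  qed fact
  then show ?thesis by (simp only: expectation_card_initial)
qed

definition displacement_bound :: real where
  "displacement_bound = real CARD('N) * R"

lemma displacement_bound_nonneg: "0 \<le> displacement_bound"
  using R_pos by (simp add: displacement_bound_def)

lemma AE_norm_displacement_le: "AE y in \<eta>. norm y \<le> displacement_bound"
  using bounded_\<eta>
proof eventually_elim
  case (elim y)
  have "norm y \<le> (\<Sum>i\<in>UNIV. \<bar>y $ i\<bar>)" by (rule norm_le_l1_cart)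
  also have "\<dots> \<le> (\<Sum>i\<in>(UNIV :: 'N set). R)" using elim by (intro sum_mono) auto
  finally show ?case by (simp add: displacement_bound_def)
qed

lemma integrable_\<eta>: "integrable \<eta> (\<lambda>y. y)"
  by (rule \<eta>.integrable_const_bound[OF AE_norm_displacement_le]) measurable

lemma lyapunov_total_norm: "jump.lyapunov (\<lambda>x. total_norm n x + displacement_bound) 3"
  unfolding jump.lyapunov_def
proof (intro conjI ballI)
  let ?V = "\<lambda>x. total_norm n x + displacement_bound"
  have "integrable \<rho> (total_norm n)"
    unfolding total_norm_def[abs_def] using integrable_\<rho>
    by (intro Bochner_Integration.integrable_sum integrable_norm) auto
  then have "integrable M (\<lambda>\<omega>. total_norm n (Y 0 \<omega>))"
    unfolding distr_Y_0[symmetric] by (subst (asm) integrable_distr_eq) auto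
  then show "integrable M (\<lambda>\<omega>. ?V (Y 0 \<omega>))"
    by simp
  fix x :: "'N state" assume "x \<in> space S"
  then have x: "x \<in> Xset n" by (simp add: space_stateM)
  show V_nonneg: "0 \<le> ?V x"
    by (simp add: total_norm_nonneg displacement_bound_nonneg)
  have "(\<integral>\<^sup>+y. ennreal (?V (toggle n i x y)) \<partial>\<eta>) \<le> ennreal (3 * ?V x)" if i: "i < n" for i
  proof -
    have "(\<integral>\<^sup>+y. ennreal (?V (toggle n i x y)) \<partial>\<eta>) \<le> (\<integral>\<^sup>+y. ennreal (3 * ?V x) \<partial>\<eta>)"
    proof (rule nn_integral_mono_AE, use AE_norm_displacement_le in eventually_elim)
      fix y :: "real^'N" assume "norm y \<le> displacement_bound"
      with total_norm_toggle_le[OF i, of x y] show "ennreal (?V (toggle n i x y)) \<le> ennreal (3 * ?V x)"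
        by (intro ennreal_leI) (simp add: algebra_simps)
    qed
    then show ?thesis by (simp add: \<eta>.emeasure_space_1)
  qed
  then have "(\<integral>\<^sup>+z. ennreal (?V z) \<partial>kernel x) \<le> (\<Sum>i<n. ennreal (r_i \<theta>a \<theta>d n i (fst x)) * ennreal (3 * ?V x))"
    by (subst nn_integral_kernel[OF x]) (auto intro!: sum_mono mult_left_mono)
  also have "\<dots> = ennreal (3 * ?V x)"
    using V_nonneg by (simp add: sum_ennreal r_i_nonneg sum_r_i flip: sum_distrib_right)
  finally show "(\<integral>\<^sup>+z. ennreal (?V z) \<partial>kernel x) \<le> ennreal (3 * ?V x)" .
qed simp_all

lemma lyapunov_dominated_total_norm:
  assumes "f \<in> borel_measurable S" and "\<And>x. \<bar>f x\<bar> \<le> total_norm n x"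
  shows "jump.lyapunov_dominated f"
  unfolding jump.lyapunov_dominated_def
  using assms lyapunov_total_norm displacement_bound_nonneg
  by (intro conjI exI[of _ "\<lambda>x. total_norm n x + displacement_bound"] exI[of _ 3]) (auto intro!: add_increasing2)

lemma integrable_centroid: "integrable M (\<lambda>\<omega>. snd (jump.state_at s \<omega>) n)" if "0 \<le> s"
proof (rule Bochner_Integration.integrable_bound)
  have "jump.lyapunov_dominated (total_norm n)"
    by (rule lyapunov_dominated_total_norm) (auto simp: total_norm_nonneg)
  then show "integrable M (\<lambda>\<omega>. total_norm n (jump.state_at s \<omega>))"
    using that by (rule jump.integrable_state_at)
qed (auto intro!: AE_I2 order_trans[OF norm_le_total_norm])

lemma expectation_centroid_component:
  assumes s: "0 \<le> s"
  shows "expectation (\<lambda>\<omega>. snd (jump.state_at s \<omega>) n $ b) = expectation (\<lambda>\<omega>. snd (Y 0 \<omega>) n $ b)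
    + s * ((\<Sum>k\<le>n. sigma_w \<theta>a \<theta>d n k * centroid_drift k) * (\<integral>y. y $ b \<partial>\<eta>))"
proof -
  let ?f = "\<lambda>x :: 'N state. snd x n $ b" and ?e = "\<integral>y. y $ b \<partial>\<eta>"
  have integrable_nth: "integrable \<eta> (\<lambda>y. y $ b)"
    by (rule integrable_bounded_linear[OF bounded_linear_vec_nth integrable_\<eta>])
  have generator_f: "generator ?f x = centroid_drift (card_psi n (fst x)) * ?e" if "x \<in> Xset n" for x
    by (rule generator_centroid[OF that integrable_nth])
  obtain B where drift_bound: "\<And>\<psi>. \<bar>centroid_drift (card_psi n \<psi>) * ?e\<bar> \<le> B"
    using bounded_fun_card_psi[of "\<lambda>k. centroid_drift k * ?e"] by blast
  have dominated: "jump.lyapunov_dominated ?f"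
    by (rule lyapunov_dominated_total_norm)
       (auto intro: order_trans[OF component_le_norm_cart norm_le_total_norm])
  have "expectation (\<lambda>\<omega>. generator ?f (jump.state_at r \<omega>))
      = (\<Sum>k\<le>n. sigma_w \<theta>a \<theta>d n k * centroid_drift k) * ?e" if "0 \<le> r" for r
  proof -
    have "expectation (\<lambda>\<omega>. generator ?f (jump.state_at r \<omega>))
        = expectation (\<lambda>\<omega>. centroid_drift (card_psi n (fst (jump.state_at r \<omega>))) * ?e)"
      by (intro Bochner_Integration.integral_cong refl generator_f)
         (use jump.state_at_in_space in \<open>simp add: space_stateM\<close>)
    also have "\<dots> = (\<Sum>k\<le>n. sigma_w \<theta>a \<theta>d n k * (centroid_drift k * ?e))"
      using that by (rule expectation_card_stationary)
    finally show ?thesis by (simp add: sum_distrib_right mult.assoc)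
  qed
  then have "(LBINT r:{0..s}. expectation (\<lambda>\<omega>. generator ?f (jump.state_at r \<omega>)))
      = (LBINT r:{0..s}. (\<Sum>k\<le>n. sigma_w \<theta>a \<theta>d n k * centroid_drift k) * ?e)"
    by (intro set_lebesgue_integral_cong) auto
  also have "\<dots> = s * ((\<Sum>k\<le>n. sigma_w \<theta>a \<theta>d n k * centroid_drift k) * ?e)"
    using s by (simp add: set_integral_const)
  finally show ?thesis
    using jump.dynkin_formula[OF dominated _ s, of B] drift_bound by (simp add: generator_f space_stateM)
qed

lemma expectation_centroid:
  assumes s: "0 \<le> s"
  shows "expectation (\<lambda>\<omega>. snd (jump.state_at s \<omega>) n) = expectation (\<lambda>\<omega>. snd (Y 0 \<omega>) n)
    + s *\<^sub>R ((\<theta>d / (\<theta>d + \<theta>a) ^ n * ((\<theta>d + \<theta>a) ^ n - \<theta>d ^ n)) *\<^sub>R (\<integral>y. y \<partial>\<eta>))"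
proof -
  have component: "(\<integral>x. g x \<partial>N) $ b = (\<integral>x. g x $ b \<partial>N)" if "integrable N g"
    for N :: "'b measure" and g :: "'b \<Rightarrow> real^'N" and b
    by (rule integral_bounded_linear[OF bounded_linear_vec_nth that, symmetric])
  have "integrable M (\<lambda>\<omega>. snd (Y 0 \<omega>) n)"
    using integrable_\<rho> unfolding distr_Y_0[symmetric] by (auto simp: integrable_distr_eq)
  then show ?thesis
    using expectation_centroid_component[OF s]
    by (simp add: vec_eq_iff component integrable_centroid[OF s] component[OF integrable_\<eta>] sum_sigma_w_centroid_drift)
qed

end

theorem theorem2:
  fixes \<theta>a \<theta>d R t :: real and n :: nat
    and \<eta> :: "(real^'N::finite) measure" and \<rho> :: "'N state measure"
    and M :: "'w measure" and Y :: "nat \<Rightarrow> 'w \<Rightarrow> 'N state" and \<gamma> :: "nat \<Rightarrow> 'w \<Rightarrow> real"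
  assumes "\<theta>a > 0" and "\<theta>d > 0" and "n > 0" and "R > 0"
    and "prob_space \<eta>" and "sets \<eta> = sets borel"
    and "AE x in \<eta>. \<forall>i. \<bar>x $ i\<bar> \<le> R"
    and "prob_space \<rho>" and "sets \<rho> = sets (stateM n)"
    and "distr \<rho> (count_space UNIV) (\<lambda>x. card_psi n (fst x))
           = density (count_space UNIV) (\<lambda>k. ennreal (sigma_w \<theta>a \<theta>d n k))"
    and "\<forall>i\<le>n. integrable \<rho> (\<lambda>x. snd x i)"
    and "prob_space M"
    and "\<forall>k. Y k \<in> measurable M (stateM n)"
    and "distr M (stateM n) (Y 0) = \<rho>"
    and "\<forall>k B. (\<forall>j. B j \<in> sets (stateM n)) \<longrightarrow>
           measure M {\<omega> \<in> space M. \<forall>j\<le>Suc k. Y j \<omega> \<in> B j}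
           = (\<integral>\<omega>. indicator {\<omega> \<in> space M. \<forall>j\<le>k. Y j \<omega> \<in> B j} \<omega>
                    * jump_kernel \<theta>a \<theta>d \<eta> n (Y k \<omega>) (B (Suc k)) \<partial>M)"
    and "\<forall>k\<ge>1. distributed M lborel (\<gamma> k) (exponential_density 1)"
    and "prob_space.indep_vars M (\<lambda>_. borel) \<gamma> {1..}"
    and "prob_space.indep_set M
           {(\<lambda>\<omega> k. Y k \<omega>) -` A \<inter> space M | A. A \<in> sets (PiM UNIV (\<lambda>_. stateM n))}
           {(\<lambda>\<omega>. restrict (\<lambda>k. \<gamma> k \<omega>) {1..}) -` A \<inter> space M | A.
               A \<in> sets (PiM {1..} (\<lambda>_. (borel :: real measure)))}"
    and "t > 0"
  shows "((\<lambda>s. \<integral>\<omega>. snd (Xproc (rate_fun \<theta>a \<theta>d n) Y \<gamma> s \<omega>) n \<partial>M)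
          has_vector_derivative
            ((\<theta>d / (\<theta>d + \<theta>a) ^ n * ((\<theta>d + \<theta>a) ^ n - \<theta>d ^ n)) *\<^sub>R (\<integral>x. x \<partial>\<eta>))) (at t)"
proof -
  interpret prob_space M by fact
  interpret attachment_process \<eta> \<theta>a \<theta>d n M \<gamma> R \<rho> Y
    using assms
    by (intro attachment_process.intro attachment_model.intro exponential_clocks.intro
        attachment_model_axioms.intro exponential_clocks_axioms.intro attachment_process_axioms.intro) auto
  let ?v = "(\<theta>d / (\<theta>d + \<theta>a) ^ n * ((\<theta>d + \<theta>a) ^ n - \<theta>d ^ n)) *\<^sub>R (\<integral>x. x \<partial>\<eta>)"
  have "((\<lambda>s. a + s *\<^sub>R v) has_vector_derivative v) (at t)" for a v :: "real^'N"
    by (auto intro!: derivative_eq_intros)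
  from this[of "expectation (\<lambda>\<omega>. snd (Y 0 \<omega>) n)" ?v] show ?thesis
    by (rule has_vector_derivative_transform_within_open[where S="{0<..}"])
       (use \<open>t > 0\<close> in \<open>auto simp: Xproc_eq_state_at expectation_centroid\<close>)
qed

end
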